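(* Let $k\in\{3,4\}$ and fix the triangulation $\mathcal{T}_h$. For penalty parameters $\gamma_1,\gamma_2$ (large enough that $A_h$ is coercive on $V_h^k$) let $u_h\in V_h^k$ be the discrete solution, i.e. $A_h(u_h,v)=\int_\Omega fv\,dx$ for all $v\in V_h^k$, and let $u_{h,\infty}\in V_{h,\infty}^k$ be the unique solution of $$a_h(u_{h,\infty},v_h)=\int_\Omega f v_h\,dx\qquad\forall v_h\in V_{h,\infty}^k .$$ Then, as the penalty parameters $\gamma_1,\gamma_2\to\infty$, $$\|u_h-u_{h,\infty}\|_h\to0 .$$
   Context: $\Omega\subset\mathbb{R}^2$ is a polygonal domain and $f\in L^2(\Omega)$. Mesh: $\mathcal{T}_h$ is a shape-regular triangulation of $\Omega$; $\mathcal{E}_h=\mathcal{E}_h^i\cup\mathcal{E}_h^b$ is the set of interior and boundary edges, $h_e$ the length of $e$; $\mathcal{V}_h$ is the set of all vertices. Each edge $e$ has a fixed unit normal $\boldsymbol n_e$ (outward to $\Omega$ on boundary edges) and corresponding unit tangent $\boldsymbol t_e$. On an interior edge shared by $T^+,T^-$, with $\boldsymbol n_e$ pointing from $T^+$ to $T^-$: $\{\!\{v\}\!\}=\tfrac12(v^++v^-)$, $[\![v]\!]=v^+-v^-$, $\partial_nv=\nabla v\cdot\boldsymbol n_e$, and similarly for $\partial_n v$ and other derived quantities. On a boundary edge, averages and jumps are both equal to the trace. $\partial_{nn},\partial_{nt}$ denote second derivatives in directions $\boldsymbol n_e,\boldsymbol t_e$; $T_e(w)=\partial_n\Delta w+\partial_{ntt}w$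 with $\partial_{ntt}w=\partial_t(\partial_{nt}w)$. $\mathcal{P}^m$ denotes polynomials of degree at most $m$, and $\mathcal{P}_e^m$ is the $L^2(e)$-orthogonal projection onto $\mathcal{P}^m(e)$. Discrete space: $V_h^k=\{v\in L^2(\Omega): v|_T\in\mathcal{P}^k(T)\ \forall T\in\mathcal{T}_h,\ [\![v]\!](\boldsymbol z)=0\ \forall \boldsymbol z\in\mathcal{V}_h\}$, i.e. $v$ is single-valued at each interior vertex and vanishes at each boundary vertex. Constrained subspace: $V_{h,\infty}^k=\{v\in V_h^k:\ \int_e[\![v]\!]p_e\,ds=0\ \forall p_e\in\mathcal{P}^{k-3}(e),\ \int_e[\![\partial_nv]\!]q_e\,ds=0\ \forall q_e\in\mathcal{P}^{k-2}(e),\ \forall e\in\mathcal{E}_h\}$. Bilinear form: $A_h=a_h+b_h+c_h+d_h$ with $a_h(w,v)=\sum_{T}\int_T\nabla^2w:\nabla^2v\,dx$, $b_h(w,v)=\sum_{e\in\mathcal{E}_h}\int_e(\{\!\{T_e(w)\}\!\}[\![v]\!]+\{\!\{T_e(v)\}\!\}[\![w]\!])\,ds$, $c_h(w,v)=-\sum_{e\in\mathcal{E}_h}\int_e(\{\!\{\partial_{nn}w\}\!\}[\![\partial_nv]\!]+\{\!\{\partial_{nn}v\}\!\}[\![\partial_nw]\!])\,ds$, $d_h(w,v)=\sum_{e\in\mathcal{E}_h}\int_e\big(\tfrac{\gamma_1}{h_e^3}\mathcal{P}_e^{k-3}[\![w]\!]\,\mathcal{P}_e^{k-3}[\![v]\!]+\tfrac{\gamma_2}{h_e}\mathcal{P}_e^{k-2}[\![\partial_nw]\!]\,\mathcal{P}_e^{k-2}[\![\partial_nv]\!]\big)ds$,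 where $\gamma_1,\gamma_2>0$ are penalty parameters. Norm: $\|v\|_h^2=\sum_T\|\nabla^2v\|_{0,T}^2+\sum_{e\in\mathcal{E}_h}h_e^{-1}\|\mathcal{P}_e^{k-2}[\![\partial_nv]\!]\|_{0,e}^2+\sum_{e\in\mathcal{E}_h}h_e^{-3}\|\mathcal{P}_e^{k-3}[\![v]\!]\|_{0,e}^2$. *)

theory Defs
  imports "HOL-Analysis.Analysis"
begin

section \<open>Polygonal domains and triangulations\<close>

type_synonym plane = "real ^ 2"

text \<open>Requiring \<^prop>\<open>interior (closure \<Omega>) = \<Omega>\<close> excludes slits, i.e. boundary segments with
  \<open>\<Omega>\<close> on both sides, on which an outward normal would not make sense.\<close>

definition polygonal_domain :: "plane set \<Rightarrow> bool" where
  "polygonal_domain \<Omega> \<longleftrightarrow>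
     open \<Omega> \<and> connected \<Omega> \<and> bounded \<Omega> \<and> \<Omega> \<noteq> {} \<and> interior (closure \<Omega>) = \<Omega> \<and>
     (\<exists>\<S>. finite \<S> \<and> (\<forall>s\<in>\<S>. \<exists>a b. s = closed_segment a b) \<and> frontier \<Omega> = \<Union>\<S>)"

definition shape_regular :: "real \<Rightarrow> plane set set \<Rightarrow> bool" where
  "shape_regular \<kappa> \<T> \<longleftrightarrow>
     (\<forall>T\<in>\<T>. \<exists>z r. r > 0 \<and> cball z r \<subseteq> T \<and> diameter T \<le> \<kappa> * r)"

record mesh =
  dom_of :: "plane set"
  tris :: "plane set set"
  nrm :: "plane set \<Rightarrow> plane"  \<comment> \<open>the fixed unit normal of each edge\<close>

definition edges :: "mesh \<Rightarrow> plane set set" where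
  "edges M = {e. \<exists>T\<in>tris M. e edge_of T}"

definition boundary_edges :: "mesh \<Rightarrow> plane set set" where
  "boundary_edges M = {e \<in> edges M. e \<subseteq> frontier (dom_of M)}"

definition vertices :: "mesh \<Rightarrow> plane set" where
  "vertices M = {z. \<exists>T\<in>tris M. z extreme_point_of T}"

text \<open>Two distinct elements of a \<^const>\<open>triangulation\<close> meet in a common face, so the mesh is
  conforming. On a boundary edge, the adjacent triangle lies on the side opposite to the normal,
  i.e. the normal is outward.\<close>

definition triangular_mesh :: "mesh \<Rightarrow> bool" where
  "triangular_mesh M \<longleftrightarrow>
     polygonal_domain (dom_of M) \<and>
     triangulation (tris M) \<and> (\<forall>T\<in>tris M. 2 simplex T) \<and> \<Union>(tris M) = closure (dom_of M) \<and>
     (\<forall>e\<in>edges M. norm (nrm M e) = 1 \<and> (\<forall>x\<in>e. \<forall>y\<in>e. nrm M e \<bullet> (y - x) = 0)) \<and>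
     (\<forall>e\<in>boundary_edges M. \<forall>T\<in>tris M. e edge_of T \<longrightarrow> (\<forall>x\<in>e. \<forall>y\<in>T. nrm M e \<bullet> (y - x) \<le> 0))"

definition tang :: "mesh \<Rightarrow> plane set \<Rightarrow> plane" where
  "tang M e = vector [- nrm M e $ 2, nrm M e $ 1]"

text \<open>The normal points from \<open>T\<^sup>+\<close> to \<open>T\<^sup>-\<close>. On a boundary edge, \<open>T\<^sup>+\<close> is the only adjacent
  triangle.\<close>

definition tri_plus :: "mesh \<Rightarrow> plane set \<Rightarrow> plane set" where
  "tri_plus M e =
     (THE T. T \<in> tris M \<and> e edge_of T \<and> (\<forall>x\<in>e. \<forall>y\<in>T. nrm M e \<bullet> (y - x) \<le> 0))"

definition tri_minus :: "mesh \<Rightarrow> plane set \<Rightarrow> plane set" where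
  "tri_minus M e =
     (THE T. T \<in> tris M \<and> e edge_of T \<and> (\<forall>x\<in>e. \<forall>y\<in>T. nrm M e \<bullet> (y - x) \<ge> 0))"

section \<open>Polynomials, derivatives and edge integrals\<close>

definition polys :: "nat \<Rightarrow> (plane \<Rightarrow> real) set" where
  "polys m = {p. \<exists>c :: nat \<Rightarrow> nat \<Rightarrow> real. p = (\<lambda>x. \<Sum>i\<le>m. \<Sum>j\<le>m - i. c i j * (x $ 1) ^ i * (x $ 2) ^ j)}"

definition dder :: "plane \<Rightarrow> (plane \<Rightarrow> real) \<Rightarrow> plane \<Rightarrow> real" where
  "dder d g x = frechet_derivative g (at x) d"

definition laplacian :: "(plane \<Rightarrow> real) \<Rightarrow> plane \<Rightarrow> real" where
  "laplacian g x = (\<Sum>i\<in>Basis. dder i (dder i g) x)"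

definition hess_dot :: "(plane \<Rightarrow> real) \<Rightarrow> (plane \<Rightarrow> real) \<Rightarrow> plane \<Rightarrow> real" where
  "hess_dot g h x = (\<Sum>i\<in>Basis. \<Sum>j\<in>Basis. dder i (dder j g) x * dder i (dder j h) x)"

definition square_integrable_on :: "(plane \<Rightarrow> real) \<Rightarrow> plane set \<Rightarrow> bool" where
  "square_integrable_on g S \<longleftrightarrow>
     g \<in> borel_measurable (lebesgue_on S) \<and> integrable (lebesgue_on S) (\<lambda>x. (g x)\<^sup>2)"

definition edge_length :: "plane set \<Rightarrow> real" where
  "edge_length e = diameter e"

text \<open>Integral with respect to arc length; it does not depend on which of the two orderings of
  the endpoints is chosen.\<close>

definition edge_ends :: "plane set \<Rightarrow> plane \<times> plane" where
  "edge_ends e = (SOME (a, b). e = closed_segment a b)"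

definition edge_integral :: "plane set \<Rightarrow> (plane \<Rightarrow> real) \<Rightarrow> real" where
  "edge_integral e g =
     (case edge_ends e of (a, b) \<Rightarrow> edge_length e * (LINT s|lebesgue_on {0..1}. g (linepath a b s)))"

text \<open>Polynomials on an edge are restrictions of polynomials on the plane; the projection is
  extended by zero off the edge so that it is a uniquely determined function.\<close>

definition edge_proj :: "nat \<Rightarrow> plane set \<Rightarrow> (plane \<Rightarrow> real) \<Rightarrow> plane \<Rightarrow> real" where
  "edge_proj m e g =
     (THE q. (\<exists>p\<in>polys m. q = (\<lambda>x. if x \<in> e then p x else 0)) \<and>
             (\<forall>p\<in>polys m. edge_integral e (\<lambda>x. (g x - q x) * p x) = 0))"

section \<open>Broken polynomials, averages and jumps\<close>

text \<open>A broken polynomial is an element of \<open>L\<^sup>2(\<Omega>)\<close>, so that only its values almost everywhere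
  matter. Its trace, and the traces of its derivatives, from a triangle \<open>T\<close> are those of the
  unique polynomial that coincides with it almost everywhere on \<open>T\<close>.\<close>

definition piece :: "(plane \<Rightarrow> real) \<Rightarrow> plane set \<Rightarrow> plane \<Rightarrow> real" where
  "piece v T = (THE p. (\<exists>m. p \<in> polys m) \<and> (AE x in lebesgue_on T. v x = p x))"

definition avg :: "mesh \<Rightarrow> plane set \<Rightarrow> (plane set \<Rightarrow> plane \<Rightarrow> real) \<Rightarrow> plane \<Rightarrow> real" where
  "avg M e q x =
     (if e \<in> boundary_edges M then q (tri_plus M e) x
      else (q (tri_plus M e) x + q (tri_minus M e) x) / 2)"

definition jump :: "mesh \<Rightarrow> plane set \<Rightarrow> (plane set \<Rightarrow> plane \<Rightarrow> real) \<Rightarrow> plane \<Rightarrow> real" where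
  "jump M e q x =
     (if e \<in> boundary_edges M then q (tri_plus M e) x
      else q (tri_plus M e) x - q (tri_minus M e) x)"

definition Dn :: "mesh \<Rightarrow> plane set \<Rightarrow> (plane \<Rightarrow> real) \<Rightarrow> plane set \<Rightarrow> plane \<Rightarrow> real" where
  "Dn M e v T = dder (nrm M e) (piece v T)"

definition Dnn :: "mesh \<Rightarrow> plane set \<Rightarrow> (plane \<Rightarrow> real) \<Rightarrow> plane set \<Rightarrow> plane \<Rightarrow> real" where
  "Dnn M e v T = dder (nrm M e) (dder (nrm M e) (piece v T))"

definition Te :: "mesh \<Rightarrow> plane set \<Rightarrow> (plane \<Rightarrow> real) \<Rightarrow> plane set \<Rightarrow> plane \<Rightarrow> real" where
  "Te M e v T x =
     dder (nrm M e) (laplacian (piece v T)) x +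
     dder (tang M e) (dder (tang M e) (dder (nrm M e) (piece v T))) x"

section \<open>Discrete spaces, bilinear forms and norm\<close>

definition Vh :: "mesh \<Rightarrow> nat \<Rightarrow> (plane \<Rightarrow> real) set" where
  "Vh M k = {v. square_integrable_on v (dom_of M) \<and>
     (\<forall>T\<in>tris M. \<exists>p\<in>polys k. AE x in lebesgue_on T. v x = p x) \<and>
     (\<forall>z\<in>vertices M.
        if z \<in> frontier (dom_of M)
        then \<forall>T\<in>tris M. z \<in> T \<longrightarrow> piece v T z = 0
        else \<forall>T\<in>tris M. \<forall>T'\<in>tris M. z \<in> T \<longrightarrow> z \<in> T' \<longrightarrow> piece v T z = piece v T' z)}"

definition Vh_inf :: "mesh \<Rightarrow> nat \<Rightarrow> (plane \<Rightarrow> real) set" where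
  "Vh_inf M k = {v \<in> Vh M k. \<forall>e\<in>edges M.
     (\<forall>p\<in>polys (k - 3). edge_integral e (\<lambda>x. jump M e (piece v) x * p x) = 0) \<and>
     (\<forall>q\<in>polys (k - 2). edge_integral e (\<lambda>x. jump M e (Dn M e v) x * q x) = 0)}"

definition a_form :: "mesh \<Rightarrow> (plane \<Rightarrow> real) \<Rightarrow> (plane \<Rightarrow> real) \<Rightarrow> real" where
  "a_form M w v = (\<Sum>T\<in>tris M. LINT x|lebesgue_on T. hess_dot (piece w T) (piece v T) x)"

definition b_form :: "mesh \<Rightarrow> (plane \<Rightarrow> real) \<Rightarrow> (plane \<Rightarrow> real) \<Rightarrow> real" where
  "b_form M w v = (\<Sum>e\<in>edges M. edge_integral e (\<lambda>x.
     avg M e (Te M e w) x * jump M e (piece v) x + avg M e (Te M e v) x * jump M e (piece w) x))"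

definition c_form :: "mesh \<Rightarrow> (plane \<Rightarrow> real) \<Rightarrow> (plane \<Rightarrow> real) \<Rightarrow> real" where
  "c_form M w v = - (\<Sum>e\<in>edges M. edge_integral e (\<lambda>x.
     avg M e (Dnn M e w) x * jump M e (Dn M e v) x + avg M e (Dnn M e v) x * jump M e (Dn M e w) x))"

definition d_form :: "mesh \<Rightarrow> nat \<Rightarrow> real \<Rightarrow> real \<Rightarrow> (plane \<Rightarrow> real) \<Rightarrow> (plane \<Rightarrow> real) \<Rightarrow> real" where
  "d_form M k \<gamma>1 \<gamma>2 w v = (\<Sum>e\<in>edges M. edge_integral e (\<lambda>x.
     \<gamma>1 / edge_length e ^ 3 *
       (edge_proj (k - 3) e (jump M e (piece w)) x * edge_proj (k - 3) e (jump M e (piece v)) x) +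
     \<gamma>2 / edge_length e *
       (edge_proj (k - 2) e (jump M e (Dn M e w)) x * edge_proj (k - 2) e (jump M e (Dn M e v)) x)))"

definition A_form :: "mesh \<Rightarrow> nat \<Rightarrow> real \<Rightarrow> real \<Rightarrow> (plane \<Rightarrow> real) \<Rightarrow> (plane \<Rightarrow> real) \<Rightarrow> real" where
  "A_form M k \<gamma>1 \<gamma>2 w v = a_form M w v + b_form M w v + c_form M w v + d_form M k \<gamma>1 \<gamma>2 w v"

definition norm_h :: "mesh \<Rightarrow> nat \<Rightarrow> (plane \<Rightarrow> real) \<Rightarrow> real" where
  "norm_h M k v = sqrt (
     (\<Sum>T\<in>tris M. LINT x|lebesgue_on T. hess_dot (piece v T) (piece v T) x) +
     (\<Sum>e\<in>edges M. 1 / edge_length e *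
        edge_integral e (\<lambda>x. (edge_proj (k - 2) e (jump M e (Dn M e v)) x)\<^sup>2)) +
     (\<Sum>e\<in>edges M. 1 / edge_length e ^ 3 *
        edge_integral e (\<lambda>x. (edge_proj (k - 3) e (jump M e (piece v)) x)\<^sup>2)))"

definition coercive :: "mesh \<Rightarrow> nat \<Rightarrow> real \<Rightarrow> real \<Rightarrow> bool" where
  "coercive M k \<gamma>1 \<gamma>2 \<longleftrightarrow>
     (\<exists>\<alpha>>0. \<forall>v\<in>Vh M k. \<alpha> * (norm_h M k v)\<^sup>2 \<le> A_form M k \<gamma>1 \<gamma>2 v v)"

definition load :: "mesh \<Rightarrow> (plane \<Rightarrow> real) \<Rightarrow> (plane \<Rightarrow> real) \<Rightarrow> real" where
  "load M f v = (LINT x|lebesgue_on (dom_of M). f x * v x)"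

definition discrete_solution ::
    "mesh \<Rightarrow> nat \<Rightarrow> (plane \<Rightarrow> real) \<Rightarrow> real \<Rightarrow> real \<Rightarrow> (plane \<Rightarrow> real) \<Rightarrow> bool" where
  "discrete_solution M k f \<gamma>1 \<gamma>2 u \<longleftrightarrow>
     u \<in> Vh M k \<and> (\<forall>v\<in>Vh M k. A_form M k \<gamma>1 \<gamma>2 u v = load M f v)"

definition limit_solution :: "mesh \<Rightarrow> nat \<Rightarrow> (plane \<Rightarrow> real) \<Rightarrow> (plane \<Rightarrow> real) \<Rightarrow> bool" where
  "limit_solution M k f u \<longleftrightarrow>
     u \<in> Vh_inf M k \<and> (\<forall>v\<in>Vh_inf M k. a_form M u v = load M f v)"

end

theory Submission
  imports Defs
begin

text \<open>
  Write \<open>A\<^sub>h = a + R + R\<^sup>T + \<gamma>\<^sub>1 d\<^sub>1 + \<gamma>\<^sub>2 d\<^sub>2\<close>, where \<open>R\<close> collects the consistency terms. The averages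
  of \<open>T\<^sub>e w\<close> and \<open>\<partial>\<^sub>n\<^sub>n w\<close> are polynomials of degree \<open>k - 3\<close> and \<open>k - 2\<close>, so \<open>R\<close> only sees the projected
  jumps, and these averages vanish when all second derivatives of \<open>w\<close> do. In finite dimension this
  yields \<open>2 \<bar>R(v, v)\<bar> \<le> a(v, v) / 2 + C N(v)\<close> with \<open>N = d\<^sub>1 + d\<^sub>2\<close>, hence coercivity for large
  penalties. For the error \<open>e = u\<^sub>h - u\<^sub>h\<^sub>,\<^sub>\<infinity>\<close> one has \<open>A\<^sub>h(e, v) = G(v)\<close> with a functional \<open>G\<close> that does
  not depend on the penalties and vanishes on the constrained subspace. Hence \<open>G\<close> factors through the
  jumps, \<open>G(v)\<^sup>2 \<le> c N(v)\<close>, and testing with \<open>v = e\<close> gives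
  \<open>a(e, e) + N(e) \<le> c / (min \<gamma>\<^sub>1 \<gamma>\<^sub>2 - C)\<close>.
\<close>

section \<open>Linear functionals and bilinear forms on function spaces\<close>

text \<open>Elements of \<open>Vh\<close> are functions prescribed only almost everywhere on each
  triangle, so \<open>Vh\<close> is not finite-dimensional as a set of functions, and equivalence of
  norms cannot be invoked on it directly. Finite dimension enters in two other ways: through the
  polynomials on a single triangle, and through finite families of functionals on \<open>Vh\<close>,
  whose common kernel determines their span. Degenerate forms are treated in the same spirit: a
  functional on polynomials that vanishes wherever the form does is represented by the form and then
  bounded by Cauchy-Schwarz. This takes the place of trace and inverse inequalities; the constants
  depend on the mesh, which stays fixed while the penalties grow.

  A second obstacle is that \<open>piece\<close>, \<open>tri_plus\<close>, \<open>tri_minus\<close>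
  and \<open>edge_proj\<close> are definite descriptions. Jumps and averages are known to be
  polynomials only after existence and uniqueness have been settled, which is what the geometric
  lemmas are for. Finally, \<open>u\<close> is known to solve the discrete problem only for coercive
  forms, so coercivity for large penalties has to be proved before the discrete equation may be
  used.\<close>

definition lin_closed :: "('x \<Rightarrow> real) set \<Rightarrow> bool" where
  "lin_closed V \<longleftrightarrow> (\<forall>v\<in>V. \<forall>w\<in>V. \<forall>c. (\<lambda>x. v x + c * w x) \<in> V)"

definition lin_on :: "('x \<Rightarrow> real) set \<Rightarrow> (('x \<Rightarrow> real) \<Rightarrow> real) \<Rightarrow> bool" where
  "lin_on V F \<longleftrightarrow> (\<forall>v\<in>V. \<forall>w\<in>V. \<forall>c. F (\<lambda>x. v x + c * w x) = F v + c * F w)"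

definition bilin_on ::
    "('x \<Rightarrow> real) set \<Rightarrow> (('x \<Rightarrow> real) \<Rightarrow> ('x \<Rightarrow> real) \<Rightarrow> real) \<Rightarrow> bool" where
  "bilin_on V B \<longleftrightarrow> (\<forall>w\<in>V. lin_on V (\<lambda>v. B v w) \<and> lin_on V (B w))"

lemma lin_closedD: "lin_closed V \<Longrightarrow> v \<in> V \<Longrightarrow> w \<in> V \<Longrightarrow> (\<lambda>x. v x + c * w x) \<in> V"
  by (simp add: lin_closed_def)

lemma lin_onD: "lin_on V F \<Longrightarrow> v \<in> V \<Longrightarrow> w \<in> V \<Longrightarrow> F (\<lambda>x. v x + c * w x) = F v + c * F w"
  by (simp add: lin_on_def)

lemma lin_onI:
  "(\<And>v w c. v \<in> V \<Longrightarrow> w \<in> V \<Longrightarrow> F (\<lambda>x. v x + c * w x) = F v + c * F w) \<Longrightarrow> lin_on V F"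
  by (simp add: lin_on_def)

lemma lin_on_subset: "lin_on V F \<Longrightarrow> W \<subseteq> V \<Longrightarrow> lin_on W F"
  by (auto simp: lin_on_def)

lemma lin_on_diff: "lin_on V F \<Longrightarrow> lin_on V G \<Longrightarrow> lin_on V (\<lambda>v. F v - G v)"
  by (simp add: lin_on_def algebra_simps)

lemma lin_on_scale: "lin_on V F \<Longrightarrow> lin_on V (\<lambda>v. c * F v)"
  by (simp add: lin_on_def algebra_simps)

lemma lin_on_sum: "(\<And>i. i \<in> I \<Longrightarrow> lin_on V (F i)) \<Longrightarrow> lin_on V (\<lambda>v. \<Sum>i\<in>I. F i v)"
  by (simp add: lin_on_def sum.distrib sum_distrib_left)

lemma bilin_on_left: "bilin_on V B \<Longrightarrow> w \<in> V \<Longrightarrow> lin_on V (\<lambda>v. B v w)"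
  and bilin_on_right: "bilin_on V B \<Longrightarrow> w \<in> V \<Longrightarrow> lin_on V (B w)"
  by (auto simp: bilin_on_def)

lemma bilin_onI:
  assumes "\<And>w. w \<in> V \<Longrightarrow> lin_on V (\<lambda>v. B v w)" and "\<And>w. w \<in> V \<Longrightarrow> lin_on V (B w)"
  shows "bilin_on V B"
  using assms by (simp add: bilin_on_def)

lemma bilin_on_diff: "bilin_on V A \<Longrightarrow> bilin_on V B \<Longrightarrow> bilin_on V (\<lambda>v w. A v w - B v w)"
  by (simp add: bilin_on_def lin_on_diff)

lemma bilin_on_scale: "bilin_on V A \<Longrightarrow> bilin_on V (\<lambda>v w. c * A v w)"
  by (simp add: bilin_on_def lin_on_scale)

lemma bilin_on_sum:
  "(\<And>i. i \<in> I \<Longrightarrow> bilin_on V (B i)) \<Longrightarrow> bilin_on V (\<lambda>v w. \<Sum>i\<in>I. B i v w)"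
  by (auto simp: bilin_on_def intro!: lin_on_sum)

section \<open>Linear maps between function spaces\<close>

definition lin_map ::
    "('x \<Rightarrow> real) set \<Rightarrow> ('y \<Rightarrow> real) set \<Rightarrow> (('x \<Rightarrow> real) \<Rightarrow> 'y \<Rightarrow> real) \<Rightarrow> bool" where
  "lin_map V W X \<longleftrightarrow> (\<forall>v\<in>V. X v \<in> W) \<and>
     (\<forall>v\<in>V. \<forall>w\<in>V. \<forall>c. X (\<lambda>x. v x + c * w x) = (\<lambda>x. X v x + c * X w x))"

lemma lin_mapI:
  assumes "\<And>v. v \<in> V \<Longrightarrow> X v \<in> W"
    and "\<And>v w c. v \<in> V \<Longrightarrow> w \<in> V \<Longrightarrow> X (\<lambda>x. v x + c * w x) = (\<lambda>x. X v x + c * X w x)"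
  shows "lin_map V W X"
  using assms by (simp add: lin_map_def)

lemma lin_map_mem: "lin_map V W X \<Longrightarrow> v \<in> V \<Longrightarrow> X v \<in> W"
  by (simp add: lin_map_def)

lemma lin_map_lin:
  "lin_map V W X \<Longrightarrow> v \<in> V \<Longrightarrow> w \<in> V \<Longrightarrow> X (\<lambda>x. v x + c * w x) = (\<lambda>x. X v x + c * X w x)"
  by (simp add: lin_map_def)

lemma lin_map_mono: "lin_map V W X \<Longrightarrow> W \<subseteq> W' \<Longrightarrow> lin_map V W' X"
  by (auto simp: lin_map_def)

lemma lin_map_compose: "lin_map V W X \<Longrightarrow> lin_map W U Y \<Longrightarrow> lin_map V U (\<lambda>v. Y (X v))"
  by (simp add: lin_map_def)

lemma lin_on_compose: "lin_on W F \<Longrightarrow> lin_map V W X \<Longrightarrow> lin_on V (\<lambda>v. F (X v))"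
  by (simp add: lin_on_def lin_map_def)

text \<open>Two different maps are allowed because the consistency terms pair averages of one
  argument with jumps of the other.\<close>

lemma bilin_on_compose:
  assumes "bilin_on W B" and "lin_map V W X" and "lin_map V W Y"
  shows "bilin_on V (\<lambda>v w. B (X v) (Y w))"
  using assms
  by (auto intro!: bilin_onI lin_on_compose[where X = X] lin_on_compose[where X = Y]
      intro: bilin_on_left bilin_on_right lin_map_mem)

text \<open>Linear duality for finitely many functionals on a space of arbitrary dimension. On the
  kernel \<open>W\<close> of one functional \<open>J i\<close> the remaining ones already determine
  \<open>G\<close>, so the residual \<open>H\<close> vanishes on \<open>W\<close> and must be a
  multiple of \<open>J i\<close>.\<close>

lemma functional_in_span:
  assumes "finite I" and "lin_closed V" and "\<And>i. i \<in> I \<Longrightarrow> lin_on V (J i)" and "lin_on V G"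
    and "\<And>v. v \<in> V \<Longrightarrow> (\<And>i. i \<in> I \<Longrightarrow> J i v = 0) \<Longrightarrow> G v = 0"
  shows "\<exists>c. \<forall>v\<in>V. G v = (\<Sum>i\<in>I. c i * J i v)"
  using assms
proof (induction I arbitrary: V rule: finite_induct)
  case empty
  then show ?case by auto
next
  case (insert i I)
  define W where "W = {v \<in> V. J i v = 0}"
  have W: "W \<subseteq> V" by (auto simp: W_def)
  have Ji: "lin_on V (J i)" using insert.prems(2) by simp
  have "lin_closed W"
    using insert.prems(1) lin_onD[OF Ji] by (auto simp: lin_closed_def W_def)
  then have "\<exists>c. \<forall>v\<in>W. G v = (\<Sum>j\<in>I. c j * J j v)"
    using insert.prems(2,3,4) W by (intro insert.IH) (auto intro: lin_on_subset simp: W_def)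
  then obtain c where c: "\<And>v. v \<in> W \<Longrightarrow> G v = (\<Sum>j\<in>I. c j * J j v)" by blast
  define H where "H v = G v - (\<Sum>j\<in>I. c j * J j v)" for v
  have H: "lin_on V H"
    unfolding H_def using insert.prems(2,3) by (intro lin_on_diff lin_on_sum lin_on_scale) auto
  have "\<exists>d. \<forall>v\<in>V. H v = d * J i v"
  proof (cases "\<exists>w\<in>V. J i w \<noteq> 0")
    case True
    then obtain w where w: "w \<in> V" "J i w \<noteq> 0" by blast
    have "H v = (H w / J i w) * J i v" if v: "v \<in> V" for v
    proof -
      \<comment> \<open>The projection of \<open>v\<close> onto the kernel of \<open>J i\<close>
        along \<open>w\<close>.\<close>
      let ?z = "\<lambda>x. v x + (- (J i v / J i w)) * w x"
      have "?z \<in> V" using v w insert.prems(1) by (intro lin_closedD)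
      moreover have "J i ?z = 0" unfolding lin_onD[OF Ji v w(1)] using w(2) by simp
      ultimately have "H ?z = 0" using c by (simp add: W_def H_def)
      then show ?thesis using lin_onD[OF H v w(1), of "- (J i v / J i w)"] by (simp add: field_simps)
    qed
    then show ?thesis by blast
  next
    case False
    \<comment> \<open>Here \<open>J i\<close> vanishes on all of \<open>V\<close>, so
      \<open>W\<close> is \<open>V\<close> and the coefficient is arbitrary.\<close>
    then have "H v = 0" if "v \<in> V" for v using c that by (simp add: W_def H_def)
    then show ?thesis by (intro exI[of _ 0]) auto
  qed
  then obtain d where d: "\<And>v. v \<in> V \<Longrightarrow> H v = d * J i v" by blast
  have "G v = (\<Sum>j\<in>insert i I. (c(i := d)) j * J j v)" if "v \<in> V" for v
  proof -
    have "(\<Sum>j\<in>I. (c(i := d)) j * J j v) = (\<Sum>j\<in>I. c j * J j v)"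
      using insert.hyps by (intro sum.cong) auto
    then show ?thesis using d[OF that] insert.hyps by (simp add: H_def)
  qed
  then show ?case by blast
qed

lemma lin_on_lincomb:
  assumes "lin_closed V" and "(\<lambda>_. 0) \<in> V" and "lin_on V F" and "finite I" and "\<And>i. i \<in> I \<Longrightarrow> b i \<in> V"
  shows "(\<lambda>x. \<Sum>i\<in>I. c i * b i x) \<in> V"
    and "F (\<lambda>x. \<Sum>i\<in>I. c i * b i x) = (\<Sum>i\<in>I. c i * F (b i))"
proof -
  have F0: "F (\<lambda>_. 0) = 0" using lin_onD[OF assms(3,2,2), of 1] by simp
  have "(\<lambda>x. \<Sum>i\<in>I. c i * b i x) \<in> V \<and> F (\<lambda>x. \<Sum>i\<in>I. c i * b i x) = (\<Sum>i\<in>I. c i * F (b i))"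
    using assms(4,5)
  proof (induction I rule: finite_induct)
    case empty
    then show ?case using assms(2) F0 by simp
  next
    case (insert i I)
    let ?r = "\<lambda>x. \<Sum>j\<in>I. c j * b j x"
    have r: "?r \<in> V" "F ?r = (\<Sum>j\<in>I. c j * F (b j))" using insert by auto
    have b: "b i \<in> V" using insert.prems by simp
    show ?case
      using lin_closedD[OF assms(1) r(1) b, of "c i"] lin_onD[OF assms(3) r(1) b, of "c i"] insert.hyps
      by (simp add: r(2) add.commute)
  qed
  then show "(\<lambda>x. \<Sum>i\<in>I. c i * b i x) \<in> V"
    "F (\<lambda>x. \<Sum>i\<in>I. c i * b i x) = (\<Sum>i\<in>I. c i * F (b i))" by auto
qed

text \<open>The form is only semidefinite, so the quadratic in \<open>t\<close> may degenerate to an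
  affine function, which stays nonnegative only if its slope is zero.\<close>

lemma cauchy_schwarz_form:
  assumes "lin_closed V" and B: "bilin_on V B" and sym: "\<And>v w. v \<in> V \<Longrightarrow> w \<in> V \<Longrightarrow> B v w = B w v"
    and pos: "\<And>v. v \<in> V \<Longrightarrow> 0 \<le> B v v" and v: "v \<in> V" and w: "w \<in> V"
  shows "(B v w)\<^sup>2 \<le> B v v * B w w"
proof -
  have quad: "0 \<le> B v v + 2 * t * B v w + t\<^sup>2 * B w w" for t
  proof -
    let ?z = "\<lambda>x. v x + t * w x"
    have z: "?z \<in> V" using assms by (intro lin_closedD)
    have "B ?z ?z = B v ?z + t * B w ?z" using lin_onD[OF bilin_on_left[OF B z] v w] .
    also have "\<dots> = B v v + t * B v w + t * (B w v + t * B w w)"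
      using lin_onD[OF bilin_on_right[OF B v] v w] lin_onD[OF bilin_on_right[OF B w] v w] by simp
    finally show ?thesis using pos[OF z] sym[OF v w] by (simp add: algebra_simps power2_eq_square)
  qed
  show ?thesis
  proof (cases "B w w = 0")
    case True
    have "B v w = 0"
    proof (rule ccontr)
      assume "B v w \<noteq> 0"
      \<comment> \<open>At this \<open>t\<close> the affine function takes the value -1.\<close>
      then show False using quad[of "- (B v v + 1) / (2 * B v w)"] True by (simp add: field_simps)
    qed
    then show ?thesis using True by simp
  next
    case False
    then have "0 < B w w" using pos[OF w] by simp
    \<comment> \<open>The minimiser of the quadratic.\<close>
    then show ?thesis using quad[of "- B v w / B w w"] by (simp add: field_simps power2_eq_square)
  qed
qed

section \<open>The abstract penalty method\<close>

text \<open>\<open>E\<close> plays the role of the squared norm. The factor 1/2 in the bound on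
  \<open>R\<close> leaves half of \<open>a\<close> for coercivity once the penalties exceed
  \<open>C\<close>. The argument gives a rate: the squared error is at most a constant over the
  excess of the smaller penalty over \<open>C\<close>.\<close>

lemma penalty_convergence:
  fixes V :: "('x \<Rightarrow> real) set"
  assumes V: "lin_closed V" and Vinf: "Vinf \<subseteq> V"
    and bil: "bilin_on V a" "bilin_on V R" "bilin_on V d1" "bilin_on V d2"
    and pos: "\<And>v. v \<in> V \<Longrightarrow> 0 \<le> a v v" "\<And>v. v \<in> V \<Longrightarrow> 0 \<le> d1 v v" "\<And>v. v \<in> V \<Longrightarrow> 0 \<le> d2 v v"
    and inf0: "\<And>v w. v \<in> V \<Longrightarrow> w \<in> Vinf \<Longrightarrow> R v w = 0"
      "\<And>v w. v \<in> V \<Longrightarrow> w \<in> Vinf \<Longrightarrow> d1 w v = 0" "\<And>v w. v \<in> V \<Longrightarrow> w \<in> Vinf \<Longrightarrow> d2 w v = 0"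
    and R: "\<And>v. v \<in> V \<Longrightarrow> 2 * \<bar>R v v\<bar> \<le> a v v / 2 + C * (d1 v v + d2 v v)"
    and fac: "\<And>G. lin_on V G \<Longrightarrow> (\<And>v. v \<in> Vinf \<Longrightarrow> G v = 0) \<Longrightarrow>
               \<exists>c. \<forall>v\<in>V. (G v)\<^sup>2 \<le> c * (d1 v v + d2 v v)"
    and A: "\<And>\<gamma>1 \<gamma>2 v w. v \<in> V \<Longrightarrow> w \<in> V \<Longrightarrow>
              A \<gamma>1 \<gamma>2 v w = a v w + R v w + R w v + \<gamma>1 * d1 v w + \<gamma>2 * d2 v w"
    and F: "lin_on V F"
    and u_inf: "u_inf \<in> Vinf" "\<And>v. v \<in> Vinf \<Longrightarrow> a u_inf v = F v"
    and u: "\<And>\<gamma>1 \<gamma>2. \<gamma>1 > 0 \<Longrightarrow> \<gamma>2 > 0 \<Longrightarrow>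
              (\<exists>\<alpha>>0. \<forall>v\<in>V. \<alpha> * (a v v + d1 v v + d2 v v) \<le> A \<gamma>1 \<gamma>2 v v) \<Longrightarrow>
              u \<gamma>1 \<gamma>2 \<in> V \<and> (\<forall>v\<in>V. A \<gamma>1 \<gamma>2 (u \<gamma>1 \<gamma>2) v = F v)"
  defines "E \<equiv> \<lambda>v. a v v + d1 v v + d2 v v"
  shows "((\<lambda>(\<gamma>1, \<gamma>2). E (\<lambda>x. u \<gamma>1 \<gamma>2 x - u_inf x)) \<longlongrightarrow> 0) (at_top \<times>\<^sub>F at_top)"
proof -
  have uiV: "u_inf \<in> V" using u_inf Vinf by blast
  \<comment> \<open>The residual of \<open>u_inf\<close> in the full form. Its penalty terms drop
    out because \<open>u_inf\<close> lies in \<open>Vinf\<close>; on \<open>Vinf\<close> both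
    \<open>R\<close> terms vanish as well, since in each of them the second argument is
    constrained.\<close>
  define G where "G v = F v - a u_inf v - R u_inf v - R v u_inf" for v
  have "lin_on V G" unfolding G_def using bil F uiV
    by (intro lin_on_diff) (auto intro: bilin_on_left bilin_on_right)
  moreover have "G v = 0" if "v \<in> Vinf" for v
    using that u_inf inf0(1)[of v u_inf] inf0(1)[of u_inf v] uiV Vinf by (auto simp: G_def)
  ultimately obtain c0 where c0: "\<And>v. v \<in> V \<Longrightarrow> (G v)\<^sup>2 \<le> c0 * (d1 v v + d2 v v)"
    using fac by blast
  \<comment> \<open>The constant \<open>c0\<close> comes without a sign; \<open>c\<close> must be
    positive because the Young inequality below divides by it.\<close>
  define c where "c = max c0 0 + 1"
  have c: "c > 0" by (simp add: c_def)
  have Gc: "(G v)\<^sup>2 \<le> c * (d1 v v + d2 v v)" if "v \<in> V" for v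
    by (rule order_trans[OF c0[OF that]], rule mult_right_mono) (use pos that in \<open>auto simp: c_def\<close>)
  have low: "a v v / 2 + (g - C) * (d1 v v + d2 v v) \<le> A \<gamma>1 \<gamma>2 v v"
    if v: "v \<in> V" and g: "g \<le> \<gamma>1" "g \<le> \<gamma>2" for v g \<gamma>1 \<gamma>2
  proof -
    have "g * d1 v v \<le> \<gamma>1 * d1 v v" "g * d2 v v \<le> \<gamma>2 * d2 v v"
      using g pos[OF v] by (auto intro: mult_right_mono)
    moreover have "- 2 * R v v \<le> a v v / 2 + C * (d1 v v + d2 v v)" using R[OF v] by linarith
    ultimately show ?thesis using A[OF v v, of \<gamma>1 \<gamma>2] by (simp add: algebra_simps)
  qed
  have bound: "E (\<lambda>x. u \<gamma>1 \<gamma>2 x - u_inf x) \<le> c / (g - C)"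
      and nonneg: "0 \<le> E (\<lambda>x. u \<gamma>1 \<gamma>2 x - u_inf x)"
    if g: "g \<le> \<gamma>1" "g \<le> \<gamma>2" "g \<ge> 1" "g \<ge> C + 1" for g \<gamma>1 \<gamma>2
  proof -
    let ?u = "u \<gamma>1 \<gamma>2"
    let ?e = "\<lambda>x. ?u x - u_inf x"
    \<comment> \<open>Coercivity with constant 1/2, since \<open>g - C\<close> is at least 1. Only
      now does the hypothesis on \<open>u\<close> apply.\<close>
    have "1/2 * (a v v + d1 v v + d2 v v) \<le> A \<gamma>1 \<gamma>2 v v" if v: "v \<in> V" for v
    proof -
      have "1/2 * (d1 v v + d2 v v) \<le> (g - C) * (d1 v v + d2 v v)"
        using g pos[OF v] by (intro mult_right_mono) auto
      then show ?thesis using low[OF v g(1,2)] by (simp add: algebra_simps)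
    qed
    then have "\<exists>\<alpha>>0. \<forall>v\<in>V. \<alpha> * (a v v + d1 v v + d2 v v) \<le> A \<gamma>1 \<gamma>2 v v"
      by (intro exI[of _ "1/2"]) auto
    then have uV: "?u \<in> V" and eq: "\<And>v. v \<in> V \<Longrightarrow> A \<gamma>1 \<gamma>2 ?u v = F v"
      using u[of \<gamma>1 \<gamma>2] g by auto
    have e_eq: "?e = (\<lambda>x. ?u x + (- 1) * u_inf x)" by simp
    have eV: "?e \<in> V" unfolding e_eq using V uV uiV by (rule lin_closedD)
    have l: "B ?e ?e = B ?u ?e - B u_inf ?e" if "bilin_on V B" for B
      using lin_onD[OF bilin_on_left[OF that eV] uV uiV, of "- 1"] by simp
    have r: "R ?e ?e = R ?e ?u - R ?e u_inf"
      using lin_onD[OF bilin_on_right[OF bil(2) eV] uV uiV, of "- 1"] by simp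
    \<comment> \<open>Each form is expanded by linearity; the penalty contributions of
      \<open>u_inf\<close> are zero, which leaves exactly the terms collected in
      \<open>G\<close>.\<close>
    have "A \<gamma>1 \<gamma>2 ?e ?e = A \<gamma>1 \<gamma>2 ?u ?e - (a u_inf ?e + R u_inf ?e + R ?e u_inf)"
      using A[OF eV eV, of \<gamma>1 \<gamma>2] A[OF uV eV, of \<gamma>1 \<gamma>2] l[OF bil(1)] l[OF bil(2)] l[OF bil(3)] l[OF bil(4)] r
        inf0(2,3)[OF eV u_inf(1)] by (simp add: algebra_simps)
    also have "\<dots> = G ?e" using eq[OF eV] by (simp add: G_def)
    finally have AG: "A \<gamma>1 \<gamma>2 ?e ?e = G ?e" .
    let ?g = "g - C" let ?N = "d1 ?e ?e + d2 ?e ?e"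
    have gp: "?g \<ge> 1" using g by simp
    \<comment> \<open>Young's inequality, weighted so that the bound on \<open>G\<close> turns the
      quadratic term into \<open>?g * ?N\<close>. The lower bound on the form contributes twice this
      amount, so one copy survives on the left.\<close>
    have "2 * G ?e \<le> ?g / c * (G ?e)\<^sup>2 + c / ?g"
    proof -
      have "0 \<le> (?g * G ?e - c)\<^sup>2 / (c * ?g)" using c gp by simp
      also have "\<dots> = ?g / c * (G ?e)\<^sup>2 + c / ?g - 2 * G ?e"
        using c gp by (simp add: field_simps power2_eq_square)
      finally show ?thesis by simp
    qed
    also have "?g / c * (G ?e)\<^sup>2 \<le> ?g / c * (c * ?N)"
      using Gc[OF eV] c gp by (intro mult_left_mono) auto
    also have "?g / c * (c * ?N) = ?g * ?N" using c by simp
    finally have "2 * G ?e \<le> ?g * ?N + c / ?g" by simp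
    then have "a ?e ?e + ?g * ?N \<le> c / ?g"
      using low[OF eV g(1,2)] AG by simp
    moreover have "1 * ?N \<le> ?g * ?N" using gp pos[OF eV] by (intro mult_right_mono) auto
    ultimately show "E ?e \<le> c / ?g" by (simp add: E_def)
    show "0 \<le> E ?e" using pos[OF eV] by (simp add: E_def)
  qed
  show ?thesis
  proof (rule tendstoI)
    fix \<epsilon> :: real assume \<epsilon>: "\<epsilon> > 0"
    \<comment> \<open>The 1 keeps both penalties positive; the second entry gives
      \<open>g - C\<close> > 2c / \<epsilon>, hence c / (g - C) < \<epsilon>.\<close>
    define g where "g = max 1 (C + 1 + 2 * c / \<epsilon>)"
    have "2 * c / \<epsilon> > 0" using c \<epsilon> by simp
    have g: "g \<ge> 1" "g \<ge> C + 1" and gC: "2 * c / \<epsilon> < g - C"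
      using \<open>2 * c / \<epsilon> > 0\<close> by (auto simp: g_def max_def)
    have "c / (g - C) < \<epsilon>"
    proof -
      have "g - C > 0" using gC \<open>2 * c / \<epsilon> > 0\<close> by linarith
      moreover have "2 * c < (g - C) * \<epsilon>" using gC \<epsilon> by (simp add: field_simps)
      ultimately show ?thesis using c by (simp add: field_simps)
    qed
    then have *: "\<bar>E (\<lambda>x. u \<gamma>1 \<gamma>2 x - u_inf x)\<bar> < \<epsilon>" if "g \<le> \<gamma>1" "g \<le> \<gamma>2" for \<gamma>1 \<gamma>2
      using bound[OF that g] nonneg[OF that g] by simp
    show "\<forall>\<^sub>F x in at_top \<times>\<^sub>F at_top. dist (case x of (\<gamma>1, \<gamma>2) \<Rightarrow> E (\<lambda>x. u \<gamma>1 \<gamma>2 x - u_inf x)) 0 < \<epsilon>"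
      unfolding eventually_prod_filter
      by (intro exI[of _ "\<lambda>x. g \<le> x"] conjI) (auto simp: * eventually_ge_at_top)
  qed
qed

section \<open>Bivariate polynomials\<close>

definition monomials :: "nat \<Rightarrow> (nat \<times> nat) set" where
  "monomials m = (SIGMA i:{..m}. {..m - i})"

definition mon :: "nat \<times> nat \<Rightarrow> plane \<Rightarrow> real" where
  "mon = (\<lambda>(i, j) x. (x $ 1) ^ i * (x $ 2) ^ j)"

definition poly_of :: "nat \<Rightarrow> (nat \<times> nat \<Rightarrow> real) \<Rightarrow> plane \<Rightarrow> real" where
  "poly_of m c x = (\<Sum>ij\<in>monomials m. c ij * mon ij x)"

text \<open>Outside \<open>monomials m\<close> the chosen coefficients are arbitrary, so uniqueness
  and linearity are available only for index pairs inside that set.\<close>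

definition coef :: "nat \<Rightarrow> (plane \<Rightarrow> real) \<Rightarrow> nat \<times> nat \<Rightarrow> real" where
  "coef m p = (SOME c. p = poly_of m c)"

lemma mem_monomials: "(i, j) \<in> monomials m \<longleftrightarrow> i + j \<le> m"
  by (auto simp: monomials_def)

lemma finite_monomials [simp]: "finite (monomials m)"
  by (simp add: monomials_def)

lemma poly_of_double_sum:
  "poly_of m c x = (\<Sum>i\<le>m. \<Sum>j\<le>m - i. c (i, j) * (x $ 1) ^ i * (x $ 2) ^ j)"
  unfolding poly_of_def monomials_def
  by (subst sum.Sigma) (auto intro!: sum.cong simp: mon_def mult_ac)

lemma polys_iff: "p \<in> polys m \<longleftrightarrow> (\<exists>c. p = poly_of m c)"
proof
  assume "p \<in> polys m"
  then obtain c :: "nat \<Rightarrow> nat \<Rightarrow> real"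
    where "p = (\<lambda>x. \<Sum>i\<le>m. \<Sum>j\<le>m - i. c i j * (x $ 1) ^ i * (x $ 2) ^ j)"
    by (auto simp: polys_def)
  then have "p = poly_of m (\<lambda>(i, j). c i j)" by (simp add: fun_eq_iff poly_of_double_sum)
  then show "\<exists>c. p = poly_of m c" by blast
next
  assume "\<exists>c. p = poly_of m c"
  then obtain c where "p = poly_of m c" by blast
  then have "p = (\<lambda>x. \<Sum>i\<le>m. \<Sum>j\<le>m - i. (curry c) i j * (x $ 1) ^ i * (x $ 2) ^ j)"
    by (simp add: fun_eq_iff poly_of_double_sum)
  then show "p \<in> polys m" unfolding polys_def by blast
qed

lemma poly_of_mem_polys [simp]: "poly_of m c \<in> polys m"
  by (auto simp: polys_iff)

lemma poly_of_coef: "p \<in> polys m \<Longrightarrow> p = poly_of m (coef m p)"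
  unfolding coef_def polys_iff by (rule someI_ex[of "\<lambda>c. p = poly_of m c"])

lemma lin_closed_polys: "lin_closed (polys m)"
  unfolding lin_closed_def
proof (intro ballI allI)
  fix p q and c :: real assume "p \<in> polys m" "q \<in> polys m"
  then obtain a b where "p = poly_of m a" "q = poly_of m b" by (auto simp: polys_iff)
  then have "(\<lambda>x. p x + c * q x) = poly_of m (\<lambda>ij. a ij + c * b ij)"
    by (simp add: fun_eq_iff poly_of_def sum.distrib sum_distrib_left algebra_simps)
  then show "(\<lambda>x. p x + c * q x) \<in> polys m" by simp
qed

lemma zero_mem_polys [simp]: "(\<lambda>x. 0) \<in> polys m"
  unfolding polys_iff by (rule exI[of _ "\<lambda>_. 0"]) (simp add: poly_of_def fun_eq_iff)

lemma polys_mono: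
  assumes "m \<le> n" shows "polys m \<subseteq> polys n"
proof
  fix p assume "p \<in> polys m"
  then obtain c where p: "p = poly_of m c" by (auto simp: polys_iff)
  have "monomials m \<subseteq> monomials n" using assms by (auto simp: mem_monomials)
  then have "p = poly_of n (\<lambda>ij. if ij \<in> monomials m then c ij else 0)"
    unfolding p poly_of_def fun_eq_iff by (auto intro!: sum.mono_neutral_cong_left)
  then show "p \<in> polys n" by simp
qed

lemma mon_mem_polys: "ij \<in> monomials m \<Longrightarrow> mon ij \<in> polys m"
  unfolding polys_iff
  by (rule exI[of _ "\<lambda>kl. if kl = ij then 1 else 0"])
     (simp add: poly_of_def fun_eq_iff if_distrib[of "\<lambda>c. c * _"] sum.delta cong: if_cong)

lemma polys_scale: "p \<in> polys m \<Longrightarrow> (\<lambda>x. c * p x) \<in> polys m"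
  using lin_closedD[OF lin_closed_polys zero_mem_polys, of p m c] by simp

lemma polys_add: "p \<in> polys m \<Longrightarrow> q \<in> polys m \<Longrightarrow> (\<lambda>x. p x + q x) \<in> polys m"
  using lin_closedD[OF lin_closed_polys, of p m q 1] by simp

lemma polys_diff: "p \<in> polys m \<Longrightarrow> q \<in> polys m \<Longrightarrow> (\<lambda>x. p x - q x) \<in> polys m"
  using lin_closedD[OF lin_closed_polys, of p m q "- 1"] by simp

lemma polys_sum: "(\<And>i. i \<in> I \<Longrightarrow> p i \<in> polys m) \<Longrightarrow> (\<lambda>x. \<Sum>i\<in>I. p i x) \<in> polys m"
  by (induction I rule: infinite_finite_induct) (auto intro: polys_add)

section \<open>Directional derivatives of polynomials\<close>

lemma has_derivative_mon:
  "(mon (i, j) has_derivative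
     (\<lambda>d. d $ 1 * (i * mon (i - 1, j) x) + d $ 2 * (j * mon (i, j - 1) x))) (at x)"
  unfolding mon_def split
  by (rule derivative_eq_intros bounded_linear.has_derivative[OF bounded_linear_vec_nth] refl)+
     (auto simp: fun_eq_iff algebra_simps)

lemma has_derivative_poly_of:
  "(poly_of m c has_derivative
     (\<lambda>d. \<Sum>(i, j)\<in>monomials m. c (i, j) * (d $ 1 * (i * mon (i - 1, j) x) + d $ 2 * (j * mon (i, j - 1) x)))) (at x)"
  unfolding poly_of_def[abs_def] split_def prod.collapse
proof (intro has_derivative_sum has_derivative_mult_right)
  fix ij assume "ij \<in> monomials m"
  show "(mon ij has_derivative (\<lambda>d. d $ 1 * (fst ij * mon (fst ij - 1, snd ij) x)
          + d $ 2 * (snd ij * mon (fst ij, snd ij - 1) x))) (at x)"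
    using has_derivative_mon[of "fst ij" "snd ij" x] by simp
qed

lemma dder_eqI: "(g has_derivative D) (at x) \<Longrightarrow> dder d g x = D d"
  unfolding dder_def using frechet_derivative_at by metis

lemma polys_differentiable: "p \<in> polys m \<Longrightarrow> p differentiable (at x)"
  unfolding polys_iff differentiable_def using has_derivative_poly_of by blast

lemma polys_continuous_on: "p \<in> polys m \<Longrightarrow> continuous_on S p"
  by (meson polys_differentiable continuous_at_imp_continuous_on differentiable_imp_continuous_within)

text \<open>Truncated subtraction does no harm: where an exponent would become negative, the factor
  \<open>i\<close> or \<open>j\<close> in front is zero, and for \<open>m = 0\<close> the derivative
  is the zero polynomial.\<close>

lemma dder_polys:
  assumes "p \<in> polys m" shows "dder d p \<in> polys (m - 1)"
proof -
  obtain c where p: "p = poly_of m c" using assms by (auto simp: polys_iff)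
  have "dder d p = (\<lambda>x. \<Sum>(i, j)\<in>monomials m.
      c (i, j) * (d $ 1 * (i * mon (i - 1, j) x) + d $ 2 * (j * mon (i, j - 1) x)))"
    unfolding p by (rule ext) (rule dder_eqI[OF has_derivative_poly_of])
  moreover have "(\<lambda>x. i * mon (i - 1, j) x) \<in> polys (m - 1)"
    if "(i, j) \<in> monomials m" for i j
  proof (cases "i = 0")
    case False
    then have "(i - 1, j) \<in> monomials (m - 1)" using that by (auto simp: mem_monomials)
    then show ?thesis by (intro polys_scale mon_mem_polys)
  qed simp
  moreover have "(\<lambda>x. j * mon (i, j - 1) x) \<in> polys (m - 1)"
    if "(i, j) \<in> monomials m" for i j
  proof (cases "j = 0")
    case False
    then have "(i, j - 1) \<in> monomials (m - 1)" using that by (auto simp: mem_monomials)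
    then show ?thesis by (intro polys_scale mon_mem_polys)
  qed simp
  ultimately show ?thesis
    by (auto simp: split_def intro!: polys_sum polys_scale[of "\<lambda>x. d $ 1 * _ x + _ x"]
        polys_add[OF polys_scale polys_scale])
qed

lemma dder_lin:
  assumes "\<And>x. f differentiable (at x)" and "\<And>x. g differentiable (at x)"
  shows "dder d (\<lambda>x. f x + c * g x) = (\<lambda>x. dder d f x + c * dder d g x)"
proof
  fix x
  have "((\<lambda>x. f x + c * g x) has_derivative
          (\<lambda>h. frechet_derivative f (at x) h + c * frechet_derivative g (at x) h)) (at x)"
    using assms[of x] by (intro derivative_intros) (auto simp: frechet_derivative_works[symmetric])
  then show "dder d (\<lambda>x. f x + c * g x) x = dder d f x + c * dder d g x"
    by (subst dder_eqI) (auto simp: dder_def)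
qed

lemmas dder_lin_polys = dder_lin[OF polys_differentiable polys_differentiable]

lemma dder_zero [simp]: "dder d (\<lambda>x. 0) = (\<lambda>x. 0)"
  by (rule ext, subst dder_eqI[of _ "\<lambda>_. 0"]) auto

lemma dder_direction:
  assumes "f differentiable (at x)"
  shows "dder d f x = (\<Sum>i\<in>Basis. (d \<bullet> i) * dder i f x)"
proof -
  have "linear (frechet_derivative f (at x))" using assms by (rule linear_frechet_derivative)
  then have "frechet_derivative f (at x) (\<Sum>i\<in>Basis. (d \<bullet> i) *\<^sub>R i)
      = (\<Sum>i\<in>Basis. (d \<bullet> i) * frechet_derivative f (at x) i)"
    by (simp add: linear_sum linear_scale)
  then show ?thesis by (simp add: dder_def euclidean_representation)
qed

text \<open>An open set contains a product of two intervals. For fixed second coordinate the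
  polynomial has infinitely many zeros in the first, so each of its coefficients vanishes; these are
  polynomials in the second coordinate with infinitely many zeros.\<close>

lemma poly_of_eq_0_on_open:
  assumes "open S" and "S \<noteq> {}" and zero: "\<And>x. x \<in> S \<Longrightarrow> poly_of m c x = 0" and "ij \<in> monomials m"
  shows "c ij = 0"
proof -
  obtain z e where e: "e > 0" "ball z e \<subseteq> S"
    using assms(1,2) by (metis all_not_in_conv open_contains_ball)
  \<comment> \<open>Sides of length e/2 keep the rectangle inside the ball, by comparison with the
    l1 norm.\<close>
  define A where "A a = {a<..<a + e / 2}" for a :: real
  have inf: "infinite (A a)" for a using e by (simp add: A_def)
  have mem: "vector [s, t] \<in> S" if "s \<in> A (z $ 1)" "t \<in> A (z $ 2)" for s t :: real
  proof -
    have "norm (vector [s, t] - z) \<le> \<bar>s - z $ 1\<bar> + \<bar>t - z $ 2\<bar>"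
      using norm_le_l1_cart[of "vector [s, t] - z"] by (simp add: sum_2)
    also have "\<dots> < e" using that by (auto simp: A_def)
    finally show ?thesis using e(2) by (auto simp: dist_norm norm_minus_commute)
  qed
  have 1: "(\<Sum>j\<le>m - i. c (i, j) * t ^ j) = 0" if t: "t \<in> A (z $ 2)" and i: "i \<le> m" for i t
  proof (rule ccontr)
    assume "(\<Sum>j\<le>m - i. c (i, j) * t ^ j) \<noteq> 0"
    then have "finite {s. (\<Sum>i\<le>m. (\<Sum>j\<le>m - i. c (i, j) * t ^ j) * s ^ i) = 0}"
      using i by (subst polyfun_finite_roots) auto
    moreover have "A (z $ 1) \<subseteq> {s. (\<Sum>i\<le>m. (\<Sum>j\<le>m - i. c (i, j) * t ^ j) * s ^ i) = 0}"
      using zero[OF mem[OF _ t]] by (auto simp: poly_of_double_sum sum_distrib_left sum_distrib_right mult_ac)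
    ultimately show False using inf finite_subset by blast
  qed
  obtain i j where ij: "ij = (i, j)" by force
  with assms(4) have i: "i \<le> m" and j: "j \<le> m - i" by (auto simp: monomials_def)
  show ?thesis
  proof (rule ccontr)
    assume "c ij \<noteq> 0"
    then have "finite {t. (\<Sum>j\<le>m - i. c (i, j) * t ^ j) = 0}"
      using j ij by (subst polyfun_finite_roots) auto
    moreover have "A (z $ 2) \<subseteq> {t. (\<Sum>j\<le>m - i. c (i, j) * t ^ j) = 0}" using 1 i by auto
    ultimately show False using inf finite_subset by blast
  qed
qed

lemma polys_eq_0_on_open:
  assumes "open S" and "S \<noteq> {}" and p: "p \<in> polys m" and "\<And>x. x \<in> S \<Longrightarrow> p x = 0"
  shows "p = (\<lambda>x. 0)"
proof -
  have pc: "p = poly_of m (coef m p)" using p by (rule poly_of_coef)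
  then have "coef m p ij = 0" if "ij \<in> monomials m" for ij
    using poly_of_eq_0_on_open[OF assms(1,2), of m "coef m p"] assms(4) that by metis
  then show ?thesis by (subst pc) (simp add: poly_of_def fun_eq_iff)
qed

text \<open>Linearity is not built into the choice of coefficients. It follows from uniqueness: the
  combined coefficient families represent the zero polynomial.\<close>

lemma lin_on_coef:
  assumes ij: "ij \<in> monomials m" shows "lin_on (polys m) (\<lambda>p. coef m p ij)"
proof (rule lin_onI)
  fix p q and c :: real assume p: "p \<in> polys m" and q: "q \<in> polys m"
  let ?r = "\<lambda>x. p x + c * q x"
  have r: "?r \<in> polys m" using p q by (rule lin_closedD[OF lin_closed_polys])
  let ?d = "\<lambda>ij. coef m ?r ij - (coef m p ij + c * coef m q ij)"
  have "poly_of m ?d x = poly_of m (coef m ?r) x - (poly_of m (coef m p) x + c * poly_of m (coef m q) x)" for x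
    by (simp add: poly_of_def sum_subtractf sum.distrib sum_distrib_left algebra_simps)
  then have "poly_of m ?d x = 0" for x
    using poly_of_coef[OF p] poly_of_coef[OF q] poly_of_coef[OF r] by (metis diff_self)
  then have "?d ij = 0" using ij by (intro poly_of_eq_0_on_open[of UNIV m ?d]) auto
  then show "coef m ?r ij = coef m p ij + c * coef m q ij" by simp
qed

text \<open>The points of \<open>interior T\<close> at which the two polynomials differ form an open
  null set, hence none exist. Separate degrees \<open>m\<close> and \<open>n\<close> are needed
  because \<open>piece\<close> does not fix a degree.\<close>

lemma polys_AE_eq:
  assumes T: "T \<in> sets lebesgue" "interior T \<noteq> {}" and p: "p \<in> polys m" and q: "q \<in> polys n"
    and ae: "AE x in lebesgue_on T. p x = q x"
  shows "p = q"
proof -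
  let ?r = "\<lambda>x. p x - q x"
  have r: "?r \<in> polys (max m n)"
    using p q polys_mono[of m "max m n"] polys_mono[of n "max m n"] by (intro polys_diff) auto
  define N where "N = {x \<in> interior T. ?r x \<noteq> 0}"
  have "open N"
  proof -
    have "open (interior T \<inter> ?r -` (- {0}))"
      by (intro continuous_open_preimage polys_continuous_on[OF r]) auto
    then show ?thesis by (simp add: N_def Int_def vimage_def)
  qed
  moreover have "negligible N"
  proof -
    have "AE x in lebesgue. x \<in> T \<longrightarrow> p x = q x"
      using ae T by (subst (asm) AE_restrict_space_iff) auto
    then obtain Z where "Z \<in> null_sets lebesgue" "{x. \<not> (x \<in> T \<longrightarrow> p x = q x)} \<subseteq> Z"
      by (auto simp: eventually_ae_filter)
    moreover have "N \<subseteq> {x. \<not> (x \<in> T \<longrightarrow> p x = q x)}" using interior_subset by (auto simp: N_def)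
    ultimately show ?thesis by (meson negligible_iff_null_sets negligible_subset subset_trans)
  qed
  ultimately have "N = {}" using open_not_negligible by blast
  then have "?r = (\<lambda>x. 0)"
    using T r by (intro polys_eq_0_on_open[of "interior T"]) (auto simp: N_def)
  then show ?thesis by (simp add: fun_eq_iff)
qed

section \<open>Functionals and operators on polynomials\<close>

lemma polys_functional_lincomb:
  assumes F: "lin_on (polys m) F" and p: "p \<in> polys m"
  shows "F p = (\<Sum>ij\<in>monomials m. coef m p ij * F (mon ij))"
proof -
  have "F p = F (\<lambda>x. \<Sum>ij\<in>monomials m. coef m p ij * mon ij x)"
    using poly_of_coef[OF p] unfolding poly_of_def[abs_def] by simp
  also have "\<dots> = (\<Sum>ij\<in>monomials m. coef m p ij * F (mon ij))"
    by (rule lin_on_lincomb[OF lin_closed_polys zero_mem_polys F]) (auto intro: mon_mem_polys)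
  finally show ?thesis .
qed

text \<open>A Riesz representation for a possibly degenerate form. If all \<open>B (mon ij)\<close>
  vanish at \<open>p\<close>, expanding the first argument gives \<open>B p p = 0\<close>, so
  \<open>G\<close> lies in the span of these functionals; the coefficients found are those of the
  representing polynomial.\<close>

lemma polys_riesz:
  assumes B: "bilin_on (polys m) B" and G: "lin_on (polys m) G"
    and zero: "\<And>p. p \<in> polys m \<Longrightarrow> B p p = 0 \<Longrightarrow> G p = 0"
  shows "\<exists>r\<in>polys m. \<forall>p\<in>polys m. G p = B r p"
proof -
  have "\<exists>c. \<forall>p\<in>polys m. G p = (\<Sum>ij\<in>monomials m. c ij * B (mon ij) p)"
  proof (rule functional_in_span[OF finite_monomials lin_closed_polys _ G])
    show "lin_on (polys m) (B (mon ij))" if "ij \<in> monomials m" for ij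
      using that by (intro bilin_on_right[OF B] mon_mem_polys)
    fix p assume p: "p \<in> polys m" and "\<And>ij. ij \<in> monomials m \<Longrightarrow> B (mon ij) p = 0"
    then have "B p p = 0" using polys_functional_lincomb[OF bilin_on_left[OF B p] p] by simp
    then show "G p = 0" using zero p by blast
  qed
  then obtain c where c: "\<And>p. p \<in> polys m \<Longrightarrow> G p = (\<Sum>ij\<in>monomials m. c ij * B (mon ij) p)" by blast
  have "G p = B (poly_of m c) p" if p: "p \<in> polys m" for p
  proof -
    have "B (poly_of m c) p = (\<Sum>ij\<in>monomials m. c ij * B (mon ij) p)"
      unfolding poly_of_def[abs_def]
      by (rule lin_on_lincomb[OF lin_closed_polys zero_mem_polys bilin_on_left[OF B p]])
         (auto intro: mon_mem_polys)
    then show ?thesis using c[OF p] by simp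
  qed
  then show ?thesis by (intro bexI[of _ "poly_of m c"]) auto
qed

text \<open>Each coefficient of \<open>L p\<close> is a functional that vanishes on the null vectors
  of \<open>B\<close>. It is therefore represented by \<open>B\<close> and bounded by the square
  root of \<open>B p p\<close> through Cauchy-Schwarz; compactness of \<open>K\<close> bounds the
  monomials.\<close>

lemma polys_operator_bound:
  assumes B: "bilin_on (polys k) B"
    and sym: "\<And>p q. p \<in> polys k \<Longrightarrow> q \<in> polys k \<Longrightarrow> B p q = B q p"
    and pos: "\<And>p. p \<in> polys k \<Longrightarrow> 0 \<le> B p p"
    and L: "\<And>p. p \<in> polys k \<Longrightarrow> L p \<in> polys m"
    and L_lin: "\<And>p q c. p \<in> polys k \<Longrightarrow> q \<in> polys k \<Longrightarrow> L (\<lambda>x. p x + c * q x) = (\<lambda>x. L p x + c * L q x)"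
    and zero: "\<And>p. p \<in> polys k \<Longrightarrow> B p p = 0 \<Longrightarrow> L p = (\<lambda>x. 0)"
    and K: "compact K"
  shows "\<exists>C\<ge>0. \<forall>p\<in>polys k. \<forall>x\<in>K. (L p x)\<^sup>2 \<le> C * B p p"
proof -
  have "\<exists>r\<in>polys k. \<forall>p\<in>polys k. coef m (L p) ij = B r p" if ij: "ij \<in> monomials m" for ij
  proof (rule polys_riesz[OF B])
    show "lin_on (polys k) (\<lambda>p. coef m (L p) ij)"
      using lin_onD[OF lin_on_coef[OF ij] L L] by (intro lin_onI) (simp add: L_lin)
    fix p assume "p \<in> polys k" "B p p = 0"
    then have "poly_of m (coef m (L p)) = (\<lambda>x. 0)" using zero L poly_of_coef by metis
    then show "coef m (L p) ij = 0"
      using ij by (intro poly_of_eq_0_on_open[of UNIV m "coef m (L p)"]) auto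
  qed
  then obtain r where r: "\<And>ij. ij \<in> monomials m \<Longrightarrow> r ij \<in> polys k"
    and cr: "\<And>ij p. ij \<in> monomials m \<Longrightarrow> p \<in> polys k \<Longrightarrow> coef m (L p) ij = B (r ij) p"
    by metis
  have "\<exists>b. \<forall>x\<in>K. \<bar>mon ij x\<bar> \<le> b" if "ij \<in> monomials m" for ij
  proof -
    have "bounded (mon ij ` K)"
      using K that by (intro compact_imp_bounded compact_continuous_image polys_continuous_on[OF mon_mem_polys])
    then show ?thesis by (force simp: bounded_iff)
  qed
  then obtain b where b: "\<And>ij x. ij \<in> monomials m \<Longrightarrow> x \<in> K \<Longrightarrow> \<bar>mon ij x\<bar> \<le> b ij" by metis
  \<comment> \<open>The seminorms of the representing polynomials, weighted with bounds for the
    monomials on \<open>K\<close>.\<close>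
  define S where "S = (\<Sum>ij\<in>monomials m. sqrt (B (r ij) (r ij)) * \<bar>b ij\<bar>)"
  have "(L p x)\<^sup>2 \<le> S\<^sup>2 * B p p" if p: "p \<in> polys k" and x: "x \<in> K" for p x
  proof -
    have "\<bar>L p x\<bar> = \<bar>\<Sum>ij\<in>monomials m. coef m (L p) ij * mon ij x\<bar>"
      by (subst poly_of_coef[OF L[OF p]]) (simp add: poly_of_def)
    also have "\<dots> \<le> (\<Sum>ij\<in>monomials m. \<bar>coef m (L p) ij * mon ij x\<bar>)" by (rule sum_abs)
    also have "\<dots> \<le> (\<Sum>ij\<in>monomials m. sqrt (B (r ij) (r ij)) * \<bar>b ij\<bar> * sqrt (B p p))"
    proof (rule sum_mono)
      fix ij assume ij: "ij \<in> monomials m"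
      have "\<bar>coef m (L p) ij\<bar> = sqrt ((B (r ij) p)\<^sup>2)" using cr[OF ij p] by simp
      also have "\<dots> \<le> sqrt (B (r ij) (r ij) * B p p)"
        by (intro real_sqrt_le_mono cauchy_schwarz_form[OF lin_closed_polys B] sym pos r[OF ij] p)
      also have "\<dots> = sqrt (B (r ij) (r ij)) * sqrt (B p p)" by (rule real_sqrt_mult)
      finally have "\<bar>coef m (L p) ij\<bar> * \<bar>mon ij x\<bar> \<le> (sqrt (B (r ij) (r ij)) * sqrt (B p p)) * \<bar>b ij\<bar>"
        using b[OF ij x] pos[OF r[OF ij]] pos[OF p] by (intro mult_mono) auto
      then show "\<bar>coef m (L p) ij * mon ij x\<bar> \<le> sqrt (B (r ij) (r ij)) * \<bar>b ij\<bar> * sqrt (B p p)"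
        by (simp add: abs_mult mult_ac)
    qed
    also have "\<dots> = S * sqrt (B p p)" by (simp add: S_def sum_distrib_right)
    finally have "\<bar>L p x\<bar>\<^sup>2 \<le> (S * sqrt (B p p))\<^sup>2" by (intro power_mono) auto
    then show ?thesis using pos[OF p] by (simp add: power_mult_distrib)
  qed
  then show ?thesis by (intro exI[of _ "S\<^sup>2"]) auto
qed

section \<open>Edge integrals and projections\<close>

definition proper_segment :: "plane set \<Rightarrow> bool" where
  "proper_segment e \<longleftrightarrow> (\<exists>a b. a \<noteq> b \<and> e = closed_segment a b)"

text \<open>Continuity is required only on \<open>e\<close>, so that projections, which are extended
  by zero off the edge, belong to this space as well.\<close>

abbreviation cont_on :: "plane set \<Rightarrow> (plane \<Rightarrow> real) set" where
  "cont_on e \<equiv> {g. continuous_on e g}"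

abbreviation edge_ip :: "plane set \<Rightarrow> (plane \<Rightarrow> real) \<Rightarrow> (plane \<Rightarrow> real) \<Rightarrow> real" where
  "edge_ip e f g \<equiv> edge_integral e (\<lambda>x. f x * g x)"

lemma lin_closed_cont_on: "lin_closed (cont_on e)"
  by (auto simp: lin_closed_def intro!: continuous_intros)

text \<open>Resolves the choice hidden in \<open>edge_ends\<close>: one parametrisation of the edge
  serves all integrands, and which order of the endpoints was chosen never matters.\<close>

lemma edge_integral_param:
  assumes "proper_segment e"
  obtains a b where "e = closed_segment a b" and "edge_length e > 0"
    and "\<And>g. edge_integral e g = edge_length e * (LINT s|lebesgue_on {0..1}. g (linepath a b s))"
proof -
  obtain a0 b0 where 0: "a0 \<noteq> b0" "e = closed_segment a0 b0"
    using assms by (auto simp: proper_segment_def)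
  obtain a b where ab: "edge_ends e = (a, b)" by force
  have "case edge_ends e of (a, b) \<Rightarrow> e = closed_segment a b"
    unfolding edge_ends_def by (rule someI[of _ "(a0, b0)"]) (use 0 in simp)
  then have e: "e = closed_segment a b" using ab by simp
  have "0 < dist a0 b0" using 0 by simp
  also have "dist a0 b0 \<le> edge_length e"
    unfolding edge_length_def 0(2) by (intro diameter_bounded_bound compact_imp_bounded) auto
  finally have "edge_length e > 0" .
  then show ?thesis by (rule that[OF e]) (simp add: edge_integral_def ab)
qed

lemma edge_length_pos: "proper_segment e \<Longrightarrow> edge_length e > 0"
  by (rule edge_integral_param)

lemma compact_proper_segment: "proper_segment e \<Longrightarrow> compact e"
  by (auto simp: proper_segment_def)

lemma continuous_on_linepath_compose:
  assumes "continuous_on (closed_segment a b) g" shows "continuous_on {0..1} (\<lambda>s. g (linepath a b s))"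
  using assms by (rule continuous_on_compose2)
    (auto simp: continuous_on_linepath linepath_in_path image_subset_iff)

lemma edge_integral_cong:
  assumes "proper_segment e" and "\<And>x. x \<in> e \<Longrightarrow> f x = g x"
  shows "edge_integral e f = edge_integral e g"
proof -
  obtain a b where e: "e = closed_segment a b"
    and I: "\<And>g. edge_integral e g = edge_length e * (LINT s|lebesgue_on {0..1}. g (linepath a b s))"
    using edge_integral_param[OF assms(1)] by metis
  have "f (linepath a b s) = g (linepath a b s)" if "s \<in> {0..1}" for s
    using assms(2) linepath_in_path[OF that] e by blast
  then show ?thesis unfolding I
    by (intro arg_cong[where f = "(*) _"] Bochner_Integration.integral_cong) auto
qed

lemma lin_on_edge_integral:
  assumes "proper_segment e" shows "lin_on (cont_on e) (edge_integral e)"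
proof (rule lin_onI)
  fix f g and c :: real assume "f \<in> cont_on e" "g \<in> cont_on e"
  moreover obtain a b where e: "e = closed_segment a b"
    and I: "\<And>g. edge_integral e g = edge_length e * (LINT s|lebesgue_on {0..1}. g (linepath a b s))"
    using edge_integral_param[OF assms] by metis
  ultimately have "integrable (lebesgue_on {0..1}) (\<lambda>s. f (linepath a b s))"
      "integrable (lebesgue_on {0..1}) (\<lambda>s. g (linepath a b s))"
    by (auto intro!: continuous_imp_integrable_real continuous_on_linepath_compose)
  then show "edge_integral e (\<lambda>x. f x + c * g x) = edge_integral e f + c * edge_integral e g"
    unfolding I by (simp add: algebra_simps)
qed

lemma edge_integral_nonneg:
  assumes "proper_segment e" and "\<And>x. x \<in> e \<Longrightarrow> 0 \<le> g x" shows "0 \<le> edge_integral e g"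
proof -
  obtain a b where e: "e = closed_segment a b" and l: "edge_length e > 0"
    and I: "\<And>g. edge_integral e g = edge_length e * (LINT s|lebesgue_on {0..1}. g (linepath a b s))"
    using edge_integral_param[OF assms(1)] by metis
  have "0 \<le> g (linepath a b s)" if "s \<in> {0..1}" for s
    using assms(2) linepath_in_path[OF that] e by blast
  then show ?thesis unfolding I using l by (intro mult_nonneg_nonneg integral_nonneg_AE AE_I2) auto
qed

lemma edge_integral_diff:
  assumes "proper_segment e" and "continuous_on e f" and "continuous_on e g"
  shows "edge_integral e (\<lambda>x. f x - g x) = edge_integral e f - edge_integral e g"
  using lin_onD[OF lin_on_edge_integral[OF assms(1)], of f g "- 1"] assms by simp

lemma edge_integral_add:
  assumes "proper_segment e" and "continuous_on e f" and "continuous_on e g"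
  shows "edge_integral e (\<lambda>x. f x + g x) = edge_integral e f + edge_integral e g"
  using lin_onD[OF lin_on_edge_integral[OF assms(1)], of f g 1] assms by simp

lemma edge_integral_zero [simp]: "edge_integral e (\<lambda>x. 0) = 0"
  by (simp add: edge_integral_def split: prod.split)

lemma edge_integral_scale:
  assumes "proper_segment e" and "continuous_on e g"
  shows "edge_integral e (\<lambda>x. c * g x) = c * edge_integral e g"
  using lin_onD[OF lin_on_edge_integral[OF assms(1)], of "\<lambda>_. 0" g c] assms by simp

lemma edge_integral_mono:
  assumes "proper_segment e" and "continuous_on e f" and "continuous_on e g"
    and "\<And>x. x \<in> e \<Longrightarrow> f x \<le> g x"
  shows "edge_integral e f \<le> edge_integral e g"
  using edge_integral_nonneg[OF assms(1), of "\<lambda>x. g x - f x"] edge_integral_diff[OF assms(1,3,2)] assms(4)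
  by simp

lemma edge_integral_eq_0:
  assumes "proper_segment e" and g: "continuous_on e g" "\<And>x. x \<in> e \<Longrightarrow> 0 \<le> g x"
    and "edge_integral e g = 0" and "x \<in> e"
  shows "g x = 0"
proof -
  obtain a b where e: "e = closed_segment a b" and l: "edge_length e > 0"
    and I: "\<And>g. edge_integral e g = edge_length e * (LINT s|lebesgue_on {0..1}. g (linepath a b s))"
    using edge_integral_param[OF assms(1)] by metis
  let ?h = "\<lambda>s. g (linepath a b s)"
  have c: "continuous_on {0..1} ?h" using g(1) e by (simp add: continuous_on_linepath_compose)
  have "integral {0..1} ?h = (LINT s|lebesgue_on {0..1}. ?h s)"
    using c by (intro lebesgue_integral_eq_integral[symmetric] continuous_imp_integrable_real) auto
  also have "\<dots> = 0" using assms(4) l by (simp add: I)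
  finally have i0: "integral {0..1} ?h = 0" .
  have "0 \<le> ?h s" if "s \<in> {0..1}" for s using g(2) linepath_in_path[OF that] e by blast
  then have z: "\<forall>s\<in>{0..1}. ?h s = 0" using i0 c by (subst (asm) integral_eq_0_iff) auto
  obtain s where "s \<in> {0..1}" "x = linepath a b s"
    using assms(5) unfolding e by (auto simp: in_segment linepath_def)
  then show ?thesis using z by auto
qed

lemma bilin_on_edge_ip:
  assumes "proper_segment e" shows "bilin_on (cont_on e) (edge_ip e)"
proof (intro bilin_onI lin_onI)
  fix w f g and c :: real assume w: "w \<in> cont_on e" "f \<in> cont_on e" "g \<in> cont_on e"
  then have cont: "continuous_on e (\<lambda>x. f x * w x)" "continuous_on e (\<lambda>x. g x * w x)"
    by (auto intro!: continuous_intros)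
  show *: "edge_ip e (\<lambda>x. f x + c * g x) w = edge_ip e f w + c * edge_ip e g w"
    using lin_onD[OF lin_on_edge_integral[OF assms], of "\<lambda>x. f x * w x" "\<lambda>x. g x * w x" c] cont
    by (simp add: algebra_simps)
  then show "edge_ip e w (\<lambda>x. f x + c * g x) = edge_ip e w f + c * edge_ip e w g"
    by (simp add: mult.commute)
qed

lemma edge_ip_self_nonneg: "proper_segment e \<Longrightarrow> 0 \<le> edge_ip e g g"
  by (rule edge_integral_nonneg) auto

lemma edge_ip_cauchy_schwarz:
  assumes "proper_segment e" and "continuous_on e f" and "continuous_on e g"
  shows "(edge_ip e f g)\<^sup>2 \<le> edge_ip e f f * edge_ip e g g"
  using assms
  by (intro cauchy_schwarz_form[OF lin_closed_cont_on bilin_on_edge_ip[OF assms(1)]])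
     (auto simp: mult.commute edge_ip_self_nonneg)

text \<open>The pointwise inequality is integrated over the edge and then used for both
  \<open>f\<close> and its negative, which produces the absolute value.\<close>

lemma edge_ip_young:
  assumes e: "proper_segment e" and f: "continuous_on e f" and g: "continuous_on e g" and "\<epsilon> > 0"
  shows "2 * \<bar>edge_ip e f g\<bar> \<le> \<epsilon> * edge_ip e f f + edge_ip e g g / \<epsilon>"
proof -
  have *: "2 * edge_ip e h g \<le> \<epsilon> * edge_ip e h h + edge_ip e g g / \<epsilon>" if h: "continuous_on e h" for h
  proof -
    have "2 * (h x * g x) \<le> \<epsilon> * (h x * h x) + 1 / \<epsilon> * (g x * g x)" for x
    proof -
      have "0 \<le> (\<epsilon> * h x - g x)\<^sup>2 / \<epsilon>" using \<open>\<epsilon> > 0\<close> by simp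
      also have "\<dots> = \<epsilon> * (h x * h x) + 1 / \<epsilon> * (g x * g x) - 2 * (h x * g x)"
        using \<open>\<epsilon> > 0\<close> by (simp add: field_simps power2_eq_square)
      finally show ?thesis by simp
    qed
    then have "edge_integral e (\<lambda>x. 2 * (h x * g x))
        \<le> edge_integral e (\<lambda>x. \<epsilon> * (h x * h x) + 1 / \<epsilon> * (g x * g x))"
      using h g by (intro edge_integral_mono[OF e] continuous_intros)
    also have "\<dots> = edge_integral e (\<lambda>x. \<epsilon> * (h x * h x)) + edge_integral e (\<lambda>x. 1 / \<epsilon> * (g x * g x))"
      using h g by (intro edge_integral_add[OF e] continuous_intros)
    finally show ?thesis
      using h g edge_integral_scale[OF e, of "\<lambda>x. h x * g x" 2]
        edge_integral_scale[OF e, of "\<lambda>x. h x * h x" \<epsilon>] edge_integral_scale[OF e, of "\<lambda>x. g x * g x" "1 / \<epsilon>"]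
      by (simp add: continuous_on_mult)
  qed
  have "edge_ip e (\<lambda>x. - f x) g = - edge_ip e f g"
    using f g edge_integral_scale[OF e, of "\<lambda>x. f x * g x" "- 1"] by (simp add: continuous_on_mult)
  then show ?thesis using *[OF f] *[of "\<lambda>x. - f x"] f by (auto simp: abs_if continuous_on_minus)
qed

section \<open>The L2 projection on an edge\<close>

lemma edge_proj_unique:
  assumes e: "proper_segment e" and g: "continuous_on e g" and p: "p \<in> polys m"
    and orth: "\<And>r. r \<in> polys m \<Longrightarrow> edge_ip e (\<lambda>x. g x - p x) r = 0"
  shows "edge_proj m e g = (\<lambda>x. if x \<in> e then p x else 0)"
  unfolding edge_proj_def
proof (rule the_equality)
  let ?q = "\<lambda>x. if x \<in> e then p x else 0"
  have "edge_integral e (\<lambda>x. (g x - ?q x) * r x) = edge_ip e (\<lambda>x. g x - p x) r" for r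
    by (rule edge_integral_cong[OF e]) simp
  then show "(\<exists>p\<in>polys m. ?q = (\<lambda>x. if x \<in> e then p x else 0)) \<and>
        (\<forall>r\<in>polys m. edge_integral e (\<lambda>x. (g x - ?q x) * r x) = 0)"
    using p orth by auto
  fix q assume "(\<exists>p\<in>polys m. q = (\<lambda>x. if x \<in> e then p x else 0)) \<and>
        (\<forall>r\<in>polys m. edge_integral e (\<lambda>x. (g x - q x) * r x) = 0)"
  then obtain s where s: "s \<in> polys m" "q = (\<lambda>x. if x \<in> e then s x else 0)"
    and q: "\<And>r. r \<in> polys m \<Longrightarrow> edge_integral e (\<lambda>x. (g x - q x) * r x) = 0" by blast
  \<comment> \<open>The difference of two candidates is itself an admissible test polynomial, so it
    is orthogonal to itself and vanishes on \<open>e\<close>. It may be nonzero elsewhere, which is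
    why only the extensions by zero coincide.\<close>
  let ?d = "\<lambda>x. s x - p x"
  have d: "?d \<in> polys m" using s(1) p by (rule polys_diff)
  have "edge_ip e (\<lambda>x. g x - s x) ?d = edge_integral e (\<lambda>x. (g x - q x) * ?d x)"
    by (rule edge_integral_cong[OF e]) (simp add: s)
  also have "\<dots> = 0" using q[OF d] .
  finally have "edge_ip e (\<lambda>x. g x - s x) ?d = 0" .
  moreover have cont: "continuous_on e g" "continuous_on e p" "continuous_on e s" "continuous_on e ?d"
    using g polys_continuous_on[OF p] polys_continuous_on[OF s(1)] polys_continuous_on[OF d] by auto
  then have "edge_integral e (\<lambda>x. (g x - p x) * ?d x - (g x - s x) * ?d x)
      = edge_ip e (\<lambda>x. g x - p x) ?d - edge_ip e (\<lambda>x. g x - s x) ?d"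
    by (intro edge_integral_diff[OF e] continuous_intros)
  moreover have "(\<lambda>x. (g x - p x) * ?d x - (g x - s x) * ?d x) = (\<lambda>x. ?d x * ?d x)"
    by (simp add: fun_eq_iff algebra_simps)
  ultimately have "edge_ip e ?d ?d = 0" using orth[OF d] by simp
  then have "?d x * ?d x = 0" if "x \<in> e" for x
    using cont that by (intro edge_integral_eq_0[OF e, of "\<lambda>x. ?d x * ?d x"] continuous_intros) auto
  then show "q = ?q" by (auto simp: s)
qed

text \<open>The edge product may be degenerate on plane polynomials, since some of them vanish on
  \<open>e\<close>. Representation is still possible because testing with such a polynomial gives
  zero, by Cauchy-Schwarz.\<close>

lemma edge_proj_obtain:
  assumes e: "proper_segment e" and g: "continuous_on e g"
  obtains p where "p \<in> polys m" and "\<And>r. r \<in> polys m \<Longrightarrow> edge_ip e (\<lambda>x. g x - p x) r = 0"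
    and "edge_proj m e g = (\<lambda>x. if x \<in> e then p x else 0)"
proof -
  have sub: "polys m \<subseteq> cont_on e" by (auto intro: polys_continuous_on)
  have B: "bilin_on (polys m) (edge_ip e)"
    using bilin_on_edge_ip[OF e] sub by (auto simp: bilin_on_def intro: lin_on_subset)
  have "\<exists>p\<in>polys m. \<forall>r\<in>polys m. edge_ip e g r = edge_ip e p r"
  proof (rule polys_riesz[OF B])
    show "lin_on (polys m) (edge_ip e g)"
      using bilin_on_right[OF bilin_on_edge_ip[OF e], of g] g sub by (auto intro: lin_on_subset)
    fix p assume "p \<in> polys m" "edge_ip e p p = 0"
    then show "edge_ip e g p = 0"
      using edge_ip_cauchy_schwarz[OF e g, of p] by (simp add: polys_continuous_on)
  qed
  then obtain p where p: "p \<in> polys m" "\<And>r. r \<in> polys m \<Longrightarrow> edge_ip e g r = edge_ip e p r" by blast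
  have "edge_ip e (\<lambda>x. g x - p x) r = 0" if r: "r \<in> polys m" for r
  proof -
    have "edge_integral e (\<lambda>x. g x * r x - p x * r x) = edge_ip e g r - edge_ip e p r"
      using g polys_continuous_on[OF p(1)] polys_continuous_on[OF r]
      by (intro edge_integral_diff[OF e] continuous_intros)
    then show ?thesis using p(2)[OF r] by (simp add: algebra_simps)
  qed
  then show ?thesis using that p(1) edge_proj_unique[OF e g p(1)] by blast
qed

lemma edge_proj_continuous:
  assumes "proper_segment e" and "continuous_on e g" shows "continuous_on e (edge_proj m e g)"
proof -
  obtain p where "p \<in> polys m" "edge_proj m e g = (\<lambda>x. if x \<in> e then p x else 0)"
    using edge_proj_obtain[OF assms] by metis
  then show ?thesis using polys_continuous_on[of p m e] by (auto cong: continuous_on_cong)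
qed

lemma edge_proj_test:
  assumes e: "proper_segment e" and g: "continuous_on e g" and r: "r \<in> polys m"
  shows "edge_ip e (edge_proj m e g) r = edge_ip e g r"
proof -
  obtain p where p: "p \<in> polys m" "\<And>r. r \<in> polys m \<Longrightarrow> edge_ip e (\<lambda>x. g x - p x) r = 0"
    and P: "edge_proj m e g = (\<lambda>x. if x \<in> e then p x else 0)"
    using edge_proj_obtain[OF e g, of m] by blast
  have "edge_integral e (\<lambda>x. g x * r x - p x * r x) = edge_ip e g r - edge_ip e p r"
    using g polys_continuous_on[OF p(1)] polys_continuous_on[OF r]
    by (intro edge_integral_diff[OF e] continuous_intros)
  then have "edge_ip e g r = edge_ip e p r" using p(2)[OF r] by (simp add: algebra_simps)
  also have "\<dots> = edge_ip e (edge_proj m e g) r" by (rule edge_integral_cong[OF e]) (simp add: P)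
  finally show ?thesis by simp
qed

lemma edge_proj_lin:
  assumes e: "proper_segment e" and f: "continuous_on e f" and g: "continuous_on e g"
  shows "edge_proj m e (\<lambda>x. f x + c * g x) = (\<lambda>x. edge_proj m e f x + c * edge_proj m e g x)"
proof -
  obtain p where p: "p \<in> polys m" "\<And>r. r \<in> polys m \<Longrightarrow> edge_ip e (\<lambda>x. f x - p x) r = 0"
    and P: "edge_proj m e f = (\<lambda>x. if x \<in> e then p x else 0)"
    using edge_proj_obtain[OF e f, of m] by blast
  obtain q where q: "q \<in> polys m" "\<And>r. r \<in> polys m \<Longrightarrow> edge_ip e (\<lambda>x. g x - q x) r = 0"
    and Q: "edge_proj m e g = (\<lambda>x. if x \<in> e then q x else 0)"
    using edge_proj_obtain[OF e g, of m] by blast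
  have "edge_proj m e (\<lambda>x. f x + c * g x) = (\<lambda>x. if x \<in> e then p x + c * q x else 0)"
  proof (rule edge_proj_unique[OF e])
    show "continuous_on e (\<lambda>x. f x + c * g x)" using f g by (intro continuous_intros)
    show "(\<lambda>x. p x + c * q x) \<in> polys m" using p(1) q(1) by (rule lin_closedD[OF lin_closed_polys])
    fix r assume r: "r \<in> polys m"
    have "edge_ip e (\<lambda>x. (f x - p x) + c * (g x - q x)) r
        = edge_ip e (\<lambda>x. f x - p x) r + c * edge_ip e (\<lambda>x. g x - q x) r"
      using f g polys_continuous_on[OF p(1)] polys_continuous_on[OF q(1)] polys_continuous_on[OF r]
      by (intro lin_onD[OF bilin_on_left[OF bilin_on_edge_ip[OF e]]]) (auto intro!: continuous_intros)
    then show "edge_ip e (\<lambda>x. f x + c * g x - (p x + c * q x)) r = 0"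
      using p(2)[OF r] q(2)[OF r] by (simp add: algebra_simps)
  qed
  then show ?thesis by (auto simp: P Q)
qed

lemma edge_proj_eq_0_iff:
  assumes e: "proper_segment e" and g: "continuous_on e g"
  shows "edge_proj m e g = (\<lambda>x. 0) \<longleftrightarrow> (\<forall>r\<in>polys m. edge_ip e g r = 0)"
proof
  assume "edge_proj m e g = (\<lambda>x. 0)"
  then show "\<forall>r\<in>polys m. edge_ip e g r = 0" using edge_proj_test[OF e g] by force
next
  assume "\<forall>r\<in>polys m. edge_ip e g r = 0"
  then show "edge_proj m e g = (\<lambda>x. 0)"
    using edge_proj_unique[OF e g zero_mem_polys] by auto
qed

text \<open>A moment against a polynomial sees only the projection of \<open>g\<close>; this is how
  moments of jumps come under the control of the penalty terms.\<close>

lemma edge_ip_test_bound: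
  assumes e: "proper_segment e" and g: "continuous_on e g" and r: "r \<in> polys m"
  shows "(edge_ip e g r)\<^sup>2 \<le> edge_ip e r r * edge_ip e (edge_proj m e g) (edge_proj m e g)"
  using edge_ip_cauchy_schwarz[OF e edge_proj_continuous[OF e g, of m] polys_continuous_on[OF r]]
  unfolding edge_proj_test[OF e g r] by (simp add: mult.commute)

section \<open>Triangles adjacent to an edge\<close>

lemma triangular_mesh_tris:
  assumes "triangular_mesh M"
  shows "finite (tris M)"
    and "T \<in> tris M \<Longrightarrow> 2 simplex T"
    and "T \<in> tris M \<Longrightarrow> T' \<in> tris M \<Longrightarrow> T \<inter> T' face_of T"
  using assms unfolding triangular_mesh_def triangulation_def by auto

lemma simplex_2_plane:
  fixes T :: "plane set"
  assumes "2 simplex T"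
  shows "compact T" "convex T" "interior T \<noteq> {}" "T \<in> sets lebesgue" "aff_dim T = 2" "polyhedron T"
proof -
  show c: "compact T" and x: "convex T"
    using assms simplex_imp_polytope polytope_imp_compact polytope_imp_convex by blast+
  show d: "aff_dim T = 2" using assms by (rule aff_dim_simplex)
  then have "affine hull T = UNIV" using aff_dim_eq_full[of T] by simp
  then have "interior T = rel_interior T" by (simp add: rel_interior_interior)
  then show "interior T \<noteq> {}" using x d by (auto simp: rel_interior_eq_empty)
  show "T \<in> sets lebesgue" using c by (simp add: lmeasurable_compact fmeasurableD)
  show "polyhedron T" using assms by (rule simplex_imp_polyhedron)
qed

lemma finite_edges:
  assumes "triangular_mesh M" shows "finite (edges M)"
proof -
  have "edges M \<subseteq> (\<Union>T\<in>tris M. {F. F face_of T})" by (auto simp: edges_def edge_of_def)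
  moreover have "finite {F. F face_of T}" if "T \<in> tris M" for T
    using triangular_mesh_tris(2)[OF assms that] simplex_imp_polytope finite_polytope_faces by blast
  ultimately show ?thesis using triangular_mesh_tris(1)[OF assms] by (auto intro: finite_subset)
qed

lemma edge_of_proper_segment:
  assumes "2 simplex T" and "e edge_of T"
  shows "proper_segment e" "convex e" "e \<subseteq> T" "aff_dim e = 1"
proof -
  have f: "e face_of T" and d: "aff_dim e = 1" using assms(2) by (auto simp: edge_of_def)
  show "aff_dim e = 1" by fact
  show x: "convex e" using f by (rule face_of_imp_convex)
  show "e \<subseteq> T" using f by (rule face_of_imp_subset)
  have "compact e" using f simplex_2_plane[OF assms(1)] face_of_imp_compact by blast
  moreover have "collinear e" using d by (simp add: collinear_aff_dim)
  moreover have "e \<noteq> {}" using d by auto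
  ultimately obtain a b where ab: "e = closed_segment a b"
    using x compact_convex_collinear_segment by blast
  have "a \<noteq> b" using ab d by auto
  then show "proper_segment e" using ab by (auto simp: proper_segment_def)
qed

text \<open>In the plane the vectors orthogonal to \<open>q - p\<close> form a line, here spanned by
  the unit vector \<open>n\<close>; the proof is a computation in coordinates.\<close>

lemma parallel_normals:
  fixes a n p q :: plane
  assumes "p \<noteq> q" and "norm n = 1" and "n \<bullet> (q - p) = 0" and "a \<bullet> (q - p) = 0"
  shows "a = (a \<bullet> n) *\<^sub>R n"
proof -
  define d where "d = q - p"
  define l where "l = a \<bullet> n"
  have 1: "n$1 * d$1 = - (n$2 * d$2)" and 2: "a$1 * d$1 = - (a$2 * d$2)"
    using assms(3,4) by (simp_all add: d_def inner_vec_def sum_2)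
  have 3: "n$1 * n$1 = 1 - n$2 * n$2"
    using assms(2) by (simp add: norm_eq_1 inner_vec_def sum_2)
  have l: "l = a$1 * n$1 + a$2 * n$2" by (simp add: l_def inner_vec_def sum_2)
  have "d \<noteq> 0" using assms(1) by (simp add: d_def)
  then have "d$1 \<noteq> 0 \<or> d$2 \<noteq> 0" by (auto simp: vec_eq_iff forall_2)
  moreover have "(a$1 * n$2 - a$2 * n$1) * d$1 = (a$1 * d$1) * n$2 - a$2 * (n$1 * d$1)"
    by (simp add: algebra_simps)
  then have "(a$1 * n$2 - a$2 * n$1) * d$1 = 0" by (simp add: 1 2)
  moreover have "(a$1 * n$2 - a$2 * n$1) * d$2 = a$1 * (n$2 * d$2) - (a$2 * d$2) * n$1"
    by (simp add: algebra_simps)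
  then have "(a$1 * n$2 - a$2 * n$1) * d$2 = a$1 * (- (n$1 * d$1)) - (- (a$1 * d$1)) * n$1"
    by (simp only: 1 2 minus_minus)
  then have "(a$1 * n$2 - a$2 * n$1) * d$2 = 0" by simp
  ultimately have 4: "a$1 * n$2 = a$2 * n$1" by auto
  have "l * n$1 = a$1 * (n$1 * n$1) + (a$2 * n$1) * n$2" by (simp add: l algebra_simps)
  then have "l * n$1 = a$1 * (n$1 * n$1) + a$1 * (n$2 * n$2)" by (simp add: 4[symmetric])
  then have "l * n$1 = a$1" by (simp add: 3 algebra_simps)
  moreover have "l * n$2 = (a$1 * n$2) * n$1 + a$2 * (n$2 * n$2)" by (simp add: l algebra_simps)
  then have "l * n$2 = a$2 * (n$1 * n$1) + a$2 * (n$2 * n$2)" by (simp add: 4 algebra_simps)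
  then have "l * n$2 = a$2" by (simp add: 3 algebra_simps)
  ultimately have "a = l *\<^sub>R n" by (simp add: vec_eq_iff forall_2)
  then show ?thesis by (simp add: l_def)
qed

lemma edges_normal:
  assumes "triangular_mesh M" and "e \<in> edges M"
  shows "norm (nrm M e) = 1" and "x \<in> e \<Longrightarrow> y \<in> e \<Longrightarrow> nrm M e \<bullet> (y - x) = 0"
  using assms by (auto simp: triangular_mesh_def)

lemma edge_proper_segment: "triangular_mesh M \<Longrightarrow> e \<in> edges M \<Longrightarrow> proper_segment e"
  unfolding edges_def using triangular_mesh_tris(2) edge_of_proper_segment(1) by blast

lemma edge_parallel:
  assumes M: "triangular_mesh M" and e: "e \<in> edges M" and a: "\<And>x y. x \<in> e \<Longrightarrow> y \<in> e \<Longrightarrow> a \<bullet> x = a \<bullet> y"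
  shows "a = (a \<bullet> nrm M e) *\<^sub>R nrm M e"
proof -
  obtain p q where "p \<noteq> q" "e = closed_segment p q"
    using edge_proper_segment[OF M e] by (auto simp: proper_segment_def)
  then have pq: "p \<noteq> q" "p \<in> e" "q \<in> e" by auto
  have "a \<bullet> (q - p) = 0" using a[OF pq(3,2)] by (simp add: inner_diff_right)
  then show ?thesis
    by (rule parallel_normals[OF pq(1) edges_normal(1)[OF M e] edges_normal(2)[OF M e pq(2,3)]])
qed

text \<open>An edge of a triangle is an exposed face. The normal of its supporting line is constant
  on the edge, hence a nonzero multiple of \<open>nrm M e\<close>, and the sign of that multiple
  decides the side.\<close>

lemma triangle_side:
  assumes M: "triangular_mesh M" and T: "T \<in> tris M" "e edge_of T"
  shows "(\<forall>x\<in>e. \<forall>y\<in>T. nrm M e \<bullet> (y - x) \<le> 0) \<or> (\<forall>x\<in>e. \<forall>y\<in>T. nrm M e \<bullet> (y - x) \<ge> 0)"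
proof -
  have s: "2 simplex T" using triangular_mesh_tris(2)[OF M T(1)] .
  have e: "e \<in> edges M" using T by (auto simp: edges_def)
  have "e exposed_face_of T"
    using T(2) exposed_face_of_polyhedron[OF simplex_2_plane(6)[OF s]] by (simp add: edge_of_def)
  moreover have "e \<noteq> {}" "e \<noteq> T" using edge_of_proper_segment(4)[OF s T(2)] simplex_2_plane(5)[OF s] by auto
  ultimately obtain a b where ab: "T \<subseteq> {x. a \<bullet> x \<le> b}" "e = T \<inter> {x. a \<bullet> x = b}"
    unfolding exposed_face_of by blast
  then have a: "a = (a \<bullet> nrm M e) *\<^sub>R nrm M e" by (intro edge_parallel[OF M e]) auto
  have "(a \<bullet> nrm M e) * (nrm M e \<bullet> (y - x)) \<le> 0" if "x \<in> e" "y \<in> T" for x y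
  proof -
    have "a \<bullet> (y - x) \<le> 0" using ab that by (auto simp: inner_diff_right)
    then show ?thesis by (subst (asm) a) simp
  qed
  moreover have "a \<bullet> nrm M e \<noteq> 0"
  proof
    assume "a \<bullet> nrm M e = 0"
    then have "a = 0" using a by simp
    moreover obtain x where "x \<in> e" using \<open>e \<noteq> {}\<close> by blast
    ultimately have "e = T" using ab by auto
    then show False using \<open>e \<noteq> T\<close> by simp
  qed
  ultimately show ?thesis by (cases "a \<bullet> nrm M e" "0::real" rule: linorder_cases) (auto simp: mult_le_0_iff)
qed

lemma common_face_proper:
  assumes M: "triangular_mesh M" and T: "T \<in> tris M" "T' \<in> tris M" "T \<noteq> T'"
  shows "T \<inter> T' \<noteq> T"
proof
  assume "T \<inter> T' = T"
  then have "T face_of T'" using triangular_mesh_tris(3)[OF M T(2,1)] by (simp add: Int_commute)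
  then have "aff_dim T < aff_dim T'"
    using T simplex_2_plane(2)[OF triangular_mesh_tris(2)[OF M T(2)]] by (intro face_of_aff_dim_lt)
  then show False using T triangular_mesh_tris(2)[OF M] simplex_2_plane(5) by auto
qed

text \<open>A line separating the two triangles has to contain their common edge.\<close>

lemma triangle_same_side_unique:
  assumes M: "triangular_mesh M"
    and T: "T \<in> tris M" "e edge_of T" and T': "T' \<in> tris M" "e edge_of T'"
    and m: "m = nrm M e \<or> m = - nrm M e"
    and side: "\<forall>x\<in>e. \<forall>y\<in>T. m \<bullet> (y - x) \<le> 0" "\<forall>x\<in>e. \<forall>y\<in>T'. m \<bullet> (y - x) \<le> 0"
  shows "T = T'"
proof (rule ccontr)
  assume ne: "T \<noteq> T'"
  have s: "2 simplex T" "2 simplex T'" using T T' triangular_mesh_tris(2)[OF M] by auto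
  have e: "e \<in> edges M" using T by (auto simp: edges_def)
  have eT: "e \<subseteq> T" "e \<subseteq> T'" using T T' edge_of_imp_subset by auto
  have "T \<inter> T' \<inter> interior T = {}"
    using triangular_mesh_tris(3)[OF M T(1) T'(1)] common_face_proper[OF M T(1) T'(1) ne]
    by (rule face_of_disjoint_interior)
  then have "interior T \<inter> T' = {}" using interior_subset by blast
  moreover have "T' \<noteq> {}" using simplex_2_plane(3)[OF s(2)] by auto
  ultimately obtain a b where a0: "a \<noteq> 0" and a: "\<forall>x\<in>interior T. a \<bullet> x \<le> b" "\<forall>x\<in>T'. a \<bullet> x \<ge> b"
    using separating_hyperplane_sets[of "interior T" T'] simplex_2_plane[OF s(1)] simplex_2_plane[OF s(2)]
    by (auto simp: convex_interior)
  \<comment> \<open>The separation was obtained only for the interior of \<open>T\<close>; it passes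
    to \<open>T\<close>, which is the closure of its interior.\<close>
  have "closure (interior T) \<subseteq> {x. a \<bullet> x \<le> b}"
    using a(1) by (intro closure_minimal closed_halfspace_le) auto
  moreover have "closure (interior T) = T"
    using simplex_2_plane[OF s(1)] by (simp add: convex_closure_interior closure_closed compact_imp_closed)
  ultimately have aT: "\<forall>x\<in>T. a \<bullet> x \<le> b" by auto
  have ae: "a \<bullet> x = b" if "x \<in> e" for x using that aT a(2) eT by (meson order_antisym subsetD)
  have par: "a = (a \<bullet> nrm M e) *\<^sub>R nrm M e" using ae by (intro edge_parallel[OF M e]) simp
  define l where "l = (if m = nrm M e then a \<bullet> nrm M e else - (a \<bullet> nrm M e))"
  have al: "a = l *\<^sub>R m" using par m by (auto simp: l_def)
  obtain x where x: "x \<in> e" using edge_of_proper_segment(4)[OF s(1) T(2)] by fastforce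
  have flat: False if "S \<subseteq> {y. a \<bullet> y = b}" "interior S \<noteq> {}" for S
    using that a0 interior_mono[OF that(1)] by simp
  have eq: "a \<bullet> y - b = l * (m \<bullet> (y - x))" for y
    using ae[OF x] by (simp add: al inner_diff_right algebra_simps)
  \<comment> \<open>Depending on the sign of \<open>l\<close>, being on the same side of the edge
    forces one of the triangles into the separating line, although its interior is nonempty.\<close>
  show False
  proof (cases "l \<ge> 0")
    case True
    have "a \<bullet> y - b \<le> 0" if "y \<in> T'" for y
      unfolding eq using True side(2) x that by (simp add: mult_nonneg_nonpos)
    then have "T' \<subseteq> {y. a \<bullet> y = b}" using a(2) by force
    then show False using flat simplex_2_plane(3)[OF s(2)] by blast
  next
    case False
    have "a \<bullet> y - b \<ge> 0" if "y \<in> T" for y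
      unfolding eq using False side(1) x that by (simp add: mult_nonpos_nonpos)
    then have "T \<subseteq> {y. a \<bullet> y = b}" using aT by force
    then show False using flat simplex_2_plane(3)[OF s(1)] by blast
  qed
qed

lemma triangle_across_interior_edge:
  assumes M: "triangular_mesh M" and T: "T \<in> tris M" "e edge_of T" and e: "e \<notin> boundary_edges M"
    and m: "m = nrm M e \<or> m = - nrm M e" and side: "\<forall>x\<in>e. \<forall>y\<in>T. m \<bullet> (y - x) \<le> 0"
  shows "\<exists>T'\<in>tris M. e edge_of T' \<and> (\<forall>x\<in>e. \<forall>y\<in>T'. m \<bullet> (y - x) \<ge> 0)"
proof -
  let ?D = "dom_of M"
  have s: "2 simplex T" using triangular_mesh_tris(2)[OF M T(1)] .
  have eE: "e \<in> edges M" using T by (auto simp: edges_def)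
  have D: "open ?D" "\<Union>(tris M) = closure ?D" using M by (auto simp: triangular_mesh_def polygonal_domain_def)
  have m0: "m \<noteq> 0" using m edges_normal(1)[OF M eE] by auto
  note eT = edge_of_proper_segment[OF s T(2)]
  have "e \<subseteq> closure ?D" using eT(3) T(1) D(2) by auto
  moreover have "\<not> e \<subseteq> frontier ?D" using e eE by (auto simp: boundary_edges_def)
  ultimately have "?D \<inter> e \<noteq> {}" using D(1) by (auto simp: frontier_def interior_open)
  moreover have "e \<subseteq> closure (rel_interior e)" using eT(2) closure_subset by (simp add: convex_closure_rel_interior)
  \<comment> \<open>The open domain meets \<open>e\<close>, hence also its relative interior, which
    is dense in \<open>e\<close>. Such a point is not a vertex, so no triangle can touch
    \<open>T\<close> there without sharing the whole edge.\<close>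
  ultimately have "?D \<inter> rel_interior e \<noteq> {}" using open_Int_closure_eq_empty[OF D(1), of "rel_interior e"] by blast
  then obtain x where x: "x \<in> ?D" "x \<in> rel_interior e" by blast
  have xe: "x \<in> e" using x(2) rel_interior_subset by blast
  define H where "H = {y. m \<bullet> y > m \<bullet> x}"
  have "x \<in> closure H" by (simp add: H_def closure_halfspace_gt m0)
  then have "x \<in> closure (?D \<inter> H)" using open_Int_closure_subset[OF D(1), of H] x(1) by blast
  \<comment> \<open>Finiteness of the mesh makes the union of closures closed, so a single triangle
    has points beyond the edge arbitrarily close to \<open>x\<close>.\<close>
  also have "closure (?D \<inter> H) \<subseteq> (\<Union>T\<in>tris M. closure (T \<inter> H))"
  proof (rule closure_minimal)
    have "?D \<subseteq> \<Union>(tris M)" unfolding D(2) by (rule closure_subset)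
    then have "?D \<inter> H \<subseteq> (\<Union>T\<in>tris M. T \<inter> H)" by auto
    also have "\<dots> \<subseteq> (\<Union>T\<in>tris M. closure (T \<inter> H))" by (intro UN_mono closure_subset) auto
    finally show "?D \<inter> H \<subseteq> (\<Union>T\<in>tris M. closure (T \<inter> H))" .
    show "closed (\<Union>T\<in>tris M. closure (T \<inter> H))"
      using triangular_mesh_tris(1)[OF M] by (intro closed_UN) auto
  qed
  finally obtain T' where T': "T' \<in> tris M" "x \<in> closure (T' \<inter> H)" by blast
  have s': "2 simplex T'" using triangular_mesh_tris(2)[OF M T'(1)] .
  have "closed T'" using simplex_2_plane(1)[OF s'] by (rule compact_imp_closed)
  then have xT': "x \<in> T'" using T'(2) closure_mono[of "T' \<inter> H" T'] by auto
  obtain y where y: "y \<in> T'" "m \<bullet> (y - x) > 0"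
    using T'(2) by (cases "T' \<inter> H = {}") (auto simp: H_def inner_diff_right)
  have "T \<noteq> T'" using side xe y by force
  let ?F = "T \<inter> T'"
  have F: "?F face_of T" "?F face_of T'"
    using triangular_mesh_tris(3)[OF M T(1) T'(1)] triangular_mesh_tris(3)[OF M T'(1) T(1)]
    by (auto simp: Int_commute)
  have "?F \<inter> rel_interior e \<noteq> {}" using x(2) xe xT' eT(3) by blast
  then have eF: "e \<subseteq> ?F" by (rule subset_of_face_of[OF F(1) eT(3)])
  have "aff_dim ?F < 2"
    using face_of_aff_dim_lt[OF simplex_2_plane(2)[OF s] F(1) common_face_proper[OF M T(1) T'(1) \<open>T \<noteq> T'\<close>]]
      simplex_2_plane(5)[OF s] by simp
  moreover have "e face_of ?F" using T(2) face_of_subset[OF _ eF Int_lower1] by (simp add: edge_of_def)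
  then have "e = ?F \<or> aff_dim e < aff_dim ?F"
    using face_of_aff_dim_lt face_of_imp_convex F(1) by blast
  ultimately have "e = ?F" using eT(4) by auto
  then have eT': "e edge_of T'" using F(2) eT(4) by (simp add: edge_of_def)
  have "(\<forall>x\<in>e. \<forall>y\<in>T'. m \<bullet> (y - x) \<le> 0) \<or> (\<forall>x\<in>e. \<forall>y\<in>T'. m \<bullet> (y - x) \<ge> 0)"
    using m
  proof
    assume "m = - nrm M e"
    then show ?thesis using triangle_side[OF M T'(1) eT'] by (simp only: inner_minus_left) auto
  qed (use triangle_side[OF M T'(1) eT'] in simp)
  moreover have "\<not> m \<bullet> (y - x) \<le> 0" using y(2) by simp
  ultimately have "\<forall>x\<in>e. \<forall>y\<in>T'. m \<bullet> (y - x) \<ge> 0" using y(1) xe by blast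
  then show ?thesis using T'(1) eT' by blast
qed

text \<open>Both names are definite descriptions. Any triangle at the edge lies on one of its sides;
  crossing an interior edge supplies the other side, and on a boundary edge the outward normal puts
  the triangle on the plus side.\<close>

lemma
  assumes M: "triangular_mesh M" and e: "e \<in> edges M"
  shows tri_plus_mem: "tri_plus M e \<in> tris M"
    and tri_minus_mem: "e \<notin> boundary_edges M \<Longrightarrow> tri_minus M e \<in> tris M"
proof -
  let ?n = "nrm M e"
  let ?P = "\<lambda>T. T \<in> tris M \<and> e edge_of T \<and> (\<forall>x\<in>e. \<forall>y\<in>T. ?n \<bullet> (y - x) \<le> 0)"
  let ?Q = "\<lambda>T. T \<in> tris M \<and> e edge_of T \<and> (\<forall>x\<in>e. \<forall>y\<in>T. ?n \<bullet> (y - x) \<ge> 0)"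
  obtain T where T: "T \<in> tris M" "e edge_of T" using e by (auto simp: edges_def)
  have P1: "T = T'" if "?P T" "?P T'" for T T'
    using that by (intro triangle_same_side_unique[OF M, of _ e _ ?n]) auto
  have Q1: "T = T'" if "?Q T" "?Q T'" for T T'
    using that by (intro triangle_same_side_unique[OF M, of _ e _ "- ?n"]) auto
  have PQ: "?P T \<or> ?Q T" using triangle_side[OF M T] T by blast
  have P: "\<exists>T. ?P T"
  proof (cases "e \<in> boundary_edges M")
    case True
    have "\<forall>e\<in>boundary_edges M. \<forall>T\<in>tris M. e edge_of T \<longrightarrow> (\<forall>x\<in>e. \<forall>y\<in>T. nrm M e \<bullet> (y - x) \<le> 0)"
      using M unfolding triangular_mesh_def by (elim conjE)
    then have "\<forall>x\<in>e. \<forall>y\<in>T. ?n \<bullet> (y - x) \<le> 0" using T True by (elim ballE) auto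
    then show ?thesis using T by (intro exI[of _ T] conjI)
  next
    case False
    show ?thesis using PQ
    proof
      assume "?Q T"
      then show ?thesis using triangle_across_interior_edge[OF M T False, of "- ?n"] by auto
    qed blast
  qed
  then have "\<exists>!T. ?P T" using P1 by (intro ex_ex1I) auto
  then have "?P (tri_plus M e)" unfolding tri_plus_def by (rule theI')
  then show "tri_plus M e \<in> tris M" by blast
  assume int: "e \<notin> boundary_edges M"
  have "\<exists>T. ?Q T" using PQ
  proof
    assume "?P T"
    then show ?thesis using triangle_across_interior_edge[OF M T int, of ?n] by auto
  qed blast
  then have "\<exists>!T. ?Q T" using Q1 by (intro ex_ex1I) auto
  then have "?Q (tri_minus M e)" unfolding tri_minus_def by (rule theI')
  then show "tri_minus M e \<in> tris M" by blast
qed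

section \<open>Second derivatives and the energy form\<close>

lemma lin_map_dder: "lin_map (polys m) (polys (m - 1)) (dder d)"
  by (intro lin_mapI dder_polys dder_lin_polys)

lemma lin_map_dder2: "lin_map (polys m) (polys (m - 2)) (\<lambda>p. dder a (dder b p))"
  using lin_map_compose[OF lin_map_dder[of m b] lin_map_dder[of "m - 1" a]] by (simp add: numeral_2_eq_2)

lemma lin_map_laplacian: "lin_map (polys m) (polys (m - 2)) laplacian"
proof (rule lin_mapI)
  fix p assume "p \<in> polys m"
  then show "laplacian p \<in> polys (m - 2)"
    unfolding laplacian_def[abs_def] using lin_map_mem[OF lin_map_dder2] by (intro polys_sum)
next
  fix p q and c :: real assume "p \<in> polys m" "q \<in> polys m"
  then show "laplacian (\<lambda>x. p x + c * q x) = (\<lambda>x. laplacian p x + c * laplacian q x)"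
    by (simp add: fun_eq_iff laplacian_def lin_map_lin[OF lin_map_dder2] sum.distrib sum_distrib_left)
qed

lemma lin_map_add:
  assumes "lin_map V (polys m) X" and "lin_map V (polys m) Y"
  shows "lin_map V (polys m) (\<lambda>v x. X v x + Y v x)"
  using assms by (intro lin_mapI) (simp_all add: lin_map_def polys_add algebra_simps)

text \<open>Up to sign and stiffness, the effective shear force of a Kirchhoff plate with Poisson
  ratio 0. Separating it from \<open>Te\<close> turns it into an operator on polynomials, to which
  the operator bound applies.\<close>

definition shear :: "plane \<Rightarrow> plane \<Rightarrow> (plane \<Rightarrow> real) \<Rightarrow> plane \<Rightarrow> real" where
  "shear n t p x = dder n (laplacian p) x + dder t (dder t (dder n p)) x"

lemma lin_map_shear: "lin_map (polys k) (polys (k - 3)) (shear n t)"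
proof -
  have "lin_map (polys k) (polys (k - 2 - 1)) (\<lambda>p. dder n (laplacian p))"
    by (rule lin_map_compose[OF lin_map_laplacian lin_map_dder])
  moreover have "lin_map (polys k) (polys (k - 2 - 1)) (\<lambda>p. dder t (dder t (dder n p)))"
    by (rule lin_map_compose[OF lin_map_dder2 lin_map_dder])
  ultimately have "lin_map (polys k) (polys (k - 2 - 1)) (shear n t)"
    unfolding shear_def[abs_def] by (rule lin_map_add)
  then show ?thesis by (simp add: numeral_2_eq_2 numeral_3_eq_3)
qed

lemma dder_dder_eq_0:
  assumes p: "p \<in> polys k" and z: "\<And>i j. i \<in> Basis \<Longrightarrow> j \<in> Basis \<Longrightarrow> dder i (dder j p) = (\<lambda>x. 0)"
  shows "dder a (dder b p) = (\<lambda>x. 0)"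
proof
  fix x
  have *: "dder i (dder b p) x = 0" if i: "i \<in> Basis" for i
  proof -
    have F: "lin_on (polys (k - 1)) (\<lambda>g. dder i g x)"
      by (intro lin_onI) (simp add: lin_map_lin[OF lin_map_dder])
    have "dder b p = (\<lambda>x. \<Sum>j\<in>Basis. (b \<bullet> j) * dder j p x)"
      using p by (intro ext dder_direction polys_differentiable)
    then have "dder i (dder b p) x = dder i (\<lambda>x. \<Sum>j\<in>Basis. (b \<bullet> j) * dder j p x) x" by simp
    also have "dder i (\<lambda>x. \<Sum>j\<in>Basis. (b \<bullet> j) * dder j p x) x
        = (\<Sum>j\<in>Basis. (b \<bullet> j) * dder i (dder j p) x)"
      using dder_polys[OF p] by (intro lin_on_lincomb(2)[OF lin_closed_polys zero_mem_polys F]) auto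
    finally show ?thesis using z[OF i] by simp
  qed
  have "dder a (dder b p) x = (\<Sum>i\<in>Basis. (a \<bullet> i) * dder i (dder b p) x)"
    using p by (intro dder_direction polys_differentiable[OF dder_polys])
  then show "dder a (dder b p) x = 0" using * by simp
qed

lemma shear_eq_0:
  assumes p: "p \<in> polys k" and z: "\<And>i j. i \<in> Basis \<Longrightarrow> j \<in> Basis \<Longrightarrow> dder i (dder j p) = (\<lambda>x. 0)"
  shows "shear n t p = (\<lambda>x. 0)"
proof -
  have "laplacian p = (\<lambda>x. 0)" using z by (simp add: fun_eq_iff laplacian_def)
  moreover have "dder t (dder n p) = (\<lambda>x. 0)" by (rule dder_dder_eq_0[OF p z])
  ultimately show ?thesis by (simp add: shear_def[abs_def])
qed

section \<open>The energy product of a single triangle\<close>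

definition hess_ip :: "plane set \<Rightarrow> (plane \<Rightarrow> real) \<Rightarrow> (plane \<Rightarrow> real) \<Rightarrow> real" where
  "hess_ip T p q = (LINT x|lebesgue_on T. hess_dot p q x)"

lemma hess_dot_commute: "hess_dot p q = hess_dot q p"
  by (simp add: hess_dot_def fun_eq_iff mult.commute)

lemma hess_dot_integrable:
  assumes "compact T" and "p \<in> polys k" and "q \<in> polys k"
  shows "integrable (lebesgue_on T) (hess_dot p q)"
proof -
  have c: "continuous_on T (hess_dot p q)"
    unfolding hess_dot_def[abs_def]
    using polys_continuous_on[OF lin_map_mem[OF lin_map_dder2 assms(2)]]
      polys_continuous_on[OF lin_map_mem[OF lin_map_dder2 assms(3)]]
    by (intro continuous_intros)
  then have "bounded (hess_dot p q ` T)"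
    using assms(1) by (intro compact_imp_bounded compact_continuous_image)
  then obtain B where B: "\<And>x. x \<in> T \<Longrightarrow> norm (hess_dot p q x) \<le> B" by (auto simp: bounded_iff)
  have T: "T \<in> lmeasurable" using assms(1) by (rule lmeasurable_compact)
  interpret finite_measure "lebesgue_on T" using T by (rule finite_measure_lebesgue_on)
  show ?thesis
    using B c T by (intro integrable_const_bound[of _ B] AE_I2 continuous_imp_measurable_on_sets_lebesgue) auto
qed

lemma bilin_on_hess_ip:
  assumes T: "compact T" shows "bilin_on (polys k) (hess_ip T)"
proof -
  have l: "lin_on (polys k) (\<lambda>p. hess_ip T p w)" if w: "w \<in> polys k" for w
  proof (rule lin_onI)
    fix p q and c :: real assume p: "p \<in> polys k" and q: "q \<in> polys k"
    have "hess_dot (\<lambda>x. p x + c * q x) w = (\<lambda>x. hess_dot p w x + c * hess_dot q w x)"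
      using p q by (simp add: fun_eq_iff hess_dot_def lin_map_lin[OF lin_map_dder2] sum.distrib
          sum_distrib_left algebra_simps)
    then show "hess_ip T (\<lambda>x. p x + c * q x) w = hess_ip T p w + c * hess_ip T q w"
      using hess_dot_integrable[OF T p w] hess_dot_integrable[OF T q w] by (simp add: hess_ip_def)
  qed
  have "hess_ip T w = (\<lambda>p. hess_ip T p w)" for w
    by (rule ext) (simp only: hess_ip_def hess_dot_commute)
  then have "lin_on (polys k) (hess_ip T w)" if "w \<in> polys k" for w
    using l[OF that] by metis
  with l show ?thesis by (rule bilin_onI)
qed

lemma hess_dot_self_nonneg: "0 \<le> hess_dot p p x"
  by (simp add: hess_dot_def sum_nonneg)

lemma hess_ip_self_nonneg: "0 \<le> hess_ip T p p"
  unfolding hess_ip_def by (intro integral_nonneg_AE AE_I2) (simp add: hess_dot_self_nonneg)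

text \<open>Vanishing energy makes the sum of squared second derivatives zero almost everywhere on
  \<open>T\<close>; a polynomial that vanishes almost everywhere on a triangle vanishes on the whole
  plane.\<close>

lemma hess_ip_eq_0:
  assumes T: "2 simplex T" and p: "p \<in> polys k" and 0: "hess_ip T p p = 0"
    and ij: "i \<in> Basis" "j \<in> Basis"
  shows "dder i (dder j p) = (\<lambda>x. 0)"
proof (rule polys_AE_eq)
  note simplex_2_plane[OF T]
  show "T \<in> sets lebesgue" "interior T \<noteq> {}" by fact+
  show "dder i (dder j p) \<in> polys (k - 2)" by (rule lin_map_mem[OF lin_map_dder2 p])
  show "(\<lambda>x. 0) \<in> polys 0" by simp
  have "AE x in lebesgue_on T. hess_dot p p x = 0"
    using 0 hess_dot_integrable[OF \<open>compact T\<close> p p] hess_dot_self_nonneg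
    unfolding hess_ip_def by (subst (asm) integral_nonneg_eq_0_iff_AE) auto
  then show "AE x in lebesgue_on T. dder i (dder j p) x = 0"
  proof eventually_elim
    case (elim x)
    have "(\<Sum>j\<in>Basis. dder i (dder j p) x * dder i (dder j p) x) = 0"
      using elim ij unfolding hess_dot_def by (subst (asm) sum_nonneg_eq_0_iff) (auto intro: sum_nonneg)
    then show ?case using ij by (subst (asm) sum_nonneg_eq_0_iff) auto
  qed
qed

text \<open>Serves as trace inequality for operators that annihilate the null vectors of the energy.
  The compact set may lie outside \<open>T\<close>, because the polynomials live on the whole
  plane.\<close>

lemma hess_operator_bound:
  assumes T: "2 simplex T" and L: "lin_map (polys k) (polys m) L" and K: "compact K"
    and z: "\<And>p. p \<in> polys k \<Longrightarrow> (\<And>i j. i \<in> Basis \<Longrightarrow> j \<in> Basis \<Longrightarrow> dder i (dder j p) = (\<lambda>x. 0))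
              \<Longrightarrow> L p = (\<lambda>x. 0)"
  shows "\<exists>C\<ge>0. \<forall>p\<in>polys k. \<forall>x\<in>K. (L p x)\<^sup>2 \<le> C * hess_ip T p p"
proof (rule polys_operator_bound[OF bilin_on_hess_ip _ hess_ip_self_nonneg _ _ _ K])
  show "compact T" using T by (rule simplex_2_plane)
  show "hess_ip T p q = hess_ip T q p" for p q by (simp add: hess_ip_def hess_dot_commute)
  show "L p \<in> polys m" if "p \<in> polys k" for p using L that by (rule lin_map_mem)
  show "L (\<lambda>x. p x + c * q x) = (\<lambda>x. L p x + c * L q x)" if "p \<in> polys k" "q \<in> polys k" for p q c
    using L that by (rule lin_map_lin)
  show "L p = (\<lambda>x. 0)" if "p \<in> polys k" "hess_ip T p p = 0" for p
    using z[OF that(1)] hess_ip_eq_0[OF T that] by blast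
qed

section \<open>Broken polynomials\<close>

lemma piece_eqI:
  assumes T: "2 simplex T" and p: "p \<in> polys m" and ae: "AE x in lebesgue_on T. v x = p x"
  shows "piece v T = p"
  unfolding piece_def
proof (rule the_equality)
  show "(\<exists>m. p \<in> polys m) \<and> (AE x in lebesgue_on T. v x = p x)" using p ae by blast
  fix q assume "(\<exists>m. q \<in> polys m) \<and> (AE x in lebesgue_on T. v x = q x)"
  then obtain n where q: "q \<in> polys n" and aeq: "AE x in lebesgue_on T. v x = q x" by blast
  have "AE x in lebesgue_on T. q x = p x" using ae aeq by eventually_elim simp
  then show "q = p" using simplex_2_plane[OF T] q p by (intro polys_AE_eq)
qed

lemma Vh_piece:
  assumes M: "triangular_mesh M" and v: "v \<in> Vh M k" and T: "T \<in> tris M"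
  shows "piece v T \<in> polys k" and "AE x in lebesgue_on T. v x = piece v T x"
proof -
  obtain p where p: "p \<in> polys k" "AE x in lebesgue_on T. v x = p x"
    using v T by (auto simp: Vh_def)
  then have "piece v T = p" using piece_eqI[OF triangular_mesh_tris(2)[OF M T]] by blast
  then show "piece v T \<in> polys k" "AE x in lebesgue_on T. v x = piece v T x" using p by simp_all
qed

lemma piece_lin:
  assumes M: "triangular_mesh M" and v: "v \<in> Vh M k" and w: "w \<in> Vh M k" and T: "T \<in> tris M"
  shows "piece (\<lambda>x. v x + c * w x) T = (\<lambda>x. piece v T x + c * piece w T x)"
proof (rule piece_eqI[OF triangular_mesh_tris(2)[OF M T]])
  note Vh_piece[OF M v T] and Vh_piece[OF M w T]
  then show "(\<lambda>x. piece v T x + c * piece w T x) \<in> polys k" by (intro lin_closedD[OF lin_closed_polys])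
  show "AE x in lebesgue_on T. v x + c * w x = piece v T x + c * piece w T x"
    using Vh_piece(2)[OF M v T] Vh_piece(2)[OF M w T] by eventually_elim simp
qed

lemma lin_map_piece:
  "triangular_mesh M \<Longrightarrow> T \<in> tris M \<Longrightarrow> lin_map (Vh M k) (polys k) (\<lambda>v. piece v T)"
  by (intro lin_mapI) (auto simp: Vh_piece piece_lin)

lemma square_integrable_on_lincomb:
  assumes "square_integrable_on v S" and "square_integrable_on w S"
  shows "square_integrable_on (\<lambda>x. v x + c * w x) S"
proof -
  have m: "v \<in> borel_measurable (lebesgue_on S)" "w \<in> borel_measurable (lebesgue_on S)"
    and i: "integrable (lebesgue_on S) (\<lambda>x. (v x)\<^sup>2)" "integrable (lebesgue_on S) (\<lambda>x. (w x)\<^sup>2)"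
    using assms by (auto simp: square_integrable_on_def)
  have "integrable (lebesgue_on S) (\<lambda>x. (v x + c * w x)\<^sup>2)"
  proof (rule Bochner_Integration.integrable_bound)
    show "integrable (lebesgue_on S) (\<lambda>x. 2 * (v x)\<^sup>2 + 2 * c\<^sup>2 * (w x)\<^sup>2)" using i by auto
    show "(\<lambda>x. (v x + c * w x)\<^sup>2) \<in> borel_measurable (lebesgue_on S)" using m by measurable
    have "(v x + c * w x)\<^sup>2 \<le> 2 * (v x)\<^sup>2 + 2 * c\<^sup>2 * (w x)\<^sup>2" for x
      using zero_le_power2[of "v x - c * w x"] by (simp add: power2_eq_square algebra_simps)
    then show "AE x in lebesgue_on S. norm ((v x + c * w x)\<^sup>2) \<le> norm (2 * (v x)\<^sup>2 + 2 * c\<^sup>2 * (w x)\<^sup>2)"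
      by (intro AE_I2) simp
  qed
  then show ?thesis using m by (auto simp: square_integrable_on_def)
qed

lemma
  assumes "v \<in> Vh M k" and "z \<in> vertices M"
  shows Vh_boundary_vertex:
      "z \<in> frontier (dom_of M) \<Longrightarrow> T \<in> tris M \<Longrightarrow> z \<in> T \<Longrightarrow> piece v T z = 0"
    and Vh_interior_vertex:
      "z \<notin> frontier (dom_of M) \<Longrightarrow> T \<in> tris M \<Longrightarrow> z \<in> T \<Longrightarrow> T' \<in> tris M \<Longrightarrow> z \<in> T' \<Longrightarrow>
        piece v T z = piece v T' z"
proof -
  have "if z \<in> frontier (dom_of M) then \<forall>T\<in>tris M. z \<in> T \<longrightarrow> piece v T z = 0
      else \<forall>T\<in>tris M. \<forall>T'\<in>tris M. z \<in> T \<longrightarrow> z \<in> T' \<longrightarrow> piece v T z = piece v T' z"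
    using assms unfolding Vh_def by blast
  then have "z \<in> frontier (dom_of M) \<Longrightarrow> \<forall>T\<in>tris M. z \<in> T \<longrightarrow> piece v T z = 0"
    "z \<notin> frontier (dom_of M) \<Longrightarrow>
        \<forall>T\<in>tris M. \<forall>T'\<in>tris M. z \<in> T \<longrightarrow> z \<in> T' \<longrightarrow> piece v T z = piece v T' z"
    by (simp_all only: if_True if_False)
  then show "z \<in> frontier (dom_of M) \<Longrightarrow> T \<in> tris M \<Longrightarrow> z \<in> T \<Longrightarrow> piece v T z = 0"
    "z \<notin> frontier (dom_of M) \<Longrightarrow> T \<in> tris M \<Longrightarrow> z \<in> T \<Longrightarrow> T' \<in> tris M \<Longrightarrow> z \<in> T' \<Longrightarrow>
        piece v T z = piece v T' z"
    by blast+
qed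

lemma lin_closed_Vh:
  assumes M: "triangular_mesh M" shows "lin_closed (Vh M k)"
  unfolding lin_closed_def
proof (intro ballI allI)
  fix v w and c :: real assume v: "v \<in> Vh M k" and w: "w \<in> Vh M k"
  let ?u = "\<lambda>x. v x + c * w x"
  note lin = piece_lin[OF M v w, of _ c]
  have "\<exists>p\<in>polys k. AE x in lebesgue_on T. ?u x = p x" if T: "T \<in> tris M" for T
  proof
    show "AE x in lebesgue_on T. ?u x = piece v T x + c * piece w T x"
      using Vh_piece(2)[OF M v T] Vh_piece(2)[OF M w T] by eventually_elim simp
    show "(\<lambda>x. piece v T x + c * piece w T x) \<in> polys k"
      using Vh_piece(1)[OF M v T] Vh_piece(1)[OF M w T] by (rule lin_closedD[OF lin_closed_polys])
  qed
  moreover have "square_integrable_on ?u (dom_of M)"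
    using v w by (intro square_integrable_on_lincomb) (auto simp: Vh_def)
  moreover have "if z \<in> frontier (dom_of M) then \<forall>T\<in>tris M. z \<in> T \<longrightarrow> piece ?u T z = 0
      else \<forall>T\<in>tris M. \<forall>T'\<in>tris M. z \<in> T \<longrightarrow> z \<in> T' \<longrightarrow> piece ?u T z = piece ?u T' z"
    if z: "z \<in> vertices M" for z
  proof (cases "z \<in> frontier (dom_of M)")
    case True
    have "piece ?u T z = 0" if "T \<in> tris M" "z \<in> T" for T
      using Vh_boundary_vertex[OF v z True that] Vh_boundary_vertex[OF w z True that] that
      by (simp add: lin)
    then show ?thesis using True by simp
  next
    case False
    have "piece ?u T z = piece ?u T' z" if "T \<in> tris M" "z \<in> T" "T' \<in> tris M" "z \<in> T'" for T T'
      unfolding lin[OF that(1)] lin[OF that(3)]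
        Vh_interior_vertex[OF v z False that] Vh_interior_vertex[OF w z False that] ..
    then show ?thesis unfolding if_not_P[OF False] by blast
  qed
  ultimately show "?u \<in> Vh M k" unfolding Vh_def by (intro CollectI conjI ballI)
qed

lemma integrable_mult_square_integrable:
  assumes "square_integrable_on f S" and "square_integrable_on v S"
  shows "integrable (lebesgue_on S) (\<lambda>x. f x * v x)"
proof -
  have m: "f \<in> borel_measurable (lebesgue_on S)" "v \<in> borel_measurable (lebesgue_on S)"
    and i: "integrable (lebesgue_on S) (\<lambda>x. (f x)\<^sup>2)" "integrable (lebesgue_on S) (\<lambda>x. (v x)\<^sup>2)"
    using assms by (auto simp: square_integrable_on_def)
  show ?thesis
  proof (rule Bochner_Integration.integrable_bound)
    show "integrable (lebesgue_on S) (\<lambda>x. (f x)\<^sup>2 + (v x)\<^sup>2)" using i by auto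
    show "(\<lambda>x. f x * v x) \<in> borel_measurable (lebesgue_on S)" using m by measurable
    have "\<bar>f x * v x\<bar> \<le> (f x)\<^sup>2 + (v x)\<^sup>2" for x
      using sum_squares_bound[of "\<bar>f x\<bar>" "\<bar>v x\<bar>"] abs_ge_zero[of "f x * v x"]
      unfolding power2_abs abs_mult by linarith
    then show "AE x in lebesgue_on S. norm (f x * v x) \<le> norm ((f x)\<^sup>2 + (v x)\<^sup>2)"
      by (intro AE_I2) simp
  qed
qed

lemma lin_on_load:
  assumes "square_integrable_on f (dom_of M)" shows "lin_on (Vh M k) (load M f)"
proof (rule lin_onI)
  fix v w and c :: real assume "v \<in> Vh M k" "w \<in> Vh M k"
  then have "integrable (lebesgue_on (dom_of M)) (\<lambda>x. f x * v x)"
      "integrable (lebesgue_on (dom_of M)) (\<lambda>x. f x * w x)"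
    using assms by (auto simp: Vh_def intro!: integrable_mult_square_integrable)
  then show "load M f (\<lambda>x. v x + c * w x) = load M f v + c * load M f w"
    unfolding load_def
    by (simp add: distrib_left mult.left_commute[of _ c])
qed

section \<open>Jumps and averages as linear maps into polynomials\<close>

lemma lin_map_jump:
  assumes M: "triangular_mesh M" and e: "e \<in> edges M"
    and q: "\<And>T. T \<in> tris M \<Longrightarrow> lin_map V (polys m) (\<lambda>v. q v T)"
  shows "lin_map V (polys m) (\<lambda>v. jump M e (q v))"
proof -
  note p = q[OF tri_plus_mem[OF M e]]
  show ?thesis
  proof (cases "e \<in> boundary_edges M")
    case True
    then show ?thesis using p by (simp add: jump_def[abs_def])
  next
    case False
    note n = q[OF tri_minus_mem[OF M e False]]
    show ?thesis using False lin_map_mem[OF p] lin_map_mem[OF n]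
      by (intro lin_mapI)
         (simp_all add: jump_def[abs_def] lin_map_lin[OF p] lin_map_lin[OF n] polys_diff algebra_simps)
  qed
qed

lemma lin_map_avg:
  assumes M: "triangular_mesh M" and e: "e \<in> edges M"
    and q: "\<And>T. T \<in> tris M \<Longrightarrow> lin_map V (polys m) (\<lambda>v. q v T)"
  shows "lin_map V (polys m) (\<lambda>v. avg M e (q v))"
proof -
  note p = q[OF tri_plus_mem[OF M e]]
  show ?thesis
  proof (cases "e \<in> boundary_edges M")
    case True
    then show ?thesis using p by (simp add: avg_def[abs_def])
  next
    case False
    note n = q[OF tri_minus_mem[OF M e False]]
    have "(\<lambda>x. 1 / 2 * (q v (tri_plus M e) x + q v (tri_minus M e) x)) \<in> polys m" if "v \<in> V" for v
      using lin_map_mem[OF p that] lin_map_mem[OF n that] by (intro polys_scale polys_add)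
    then show ?thesis using False
      by (intro lin_mapI)
         (simp_all add: avg_def[abs_def] lin_map_lin[OF p] lin_map_lin[OF n] algebra_simps add_divide_distrib)
  qed
qed

lemma lin_map_jump_piece:
  "triangular_mesh M \<Longrightarrow> e \<in> edges M \<Longrightarrow> lin_map (Vh M k) (polys k) (\<lambda>v. jump M e (piece v))"
  by (intro lin_map_jump lin_map_piece)

lemma lin_map_jump_Dn:
  assumes "triangular_mesh M" and "e \<in> edges M"
  shows "lin_map (Vh M k) (polys (k - 1)) (\<lambda>v. jump M e (Dn M e v))"
  using assms unfolding Dn_def[abs_def]
  by (intro lin_map_jump lin_map_compose[OF lin_map_piece lin_map_dder])

lemma Te_eq: "Te M e v = (\<lambda>T. shear (nrm M e) (tang M e) (piece v T))"
  by (simp add: fun_eq_iff Te_def shear_def)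

lemma lin_map_avg_Te:
  assumes "triangular_mesh M" and "e \<in> edges M"
  shows "lin_map (Vh M k) (polys (k - 3)) (\<lambda>v. avg M e (Te M e v))"
  using assms unfolding Te_eq
  by (intro lin_map_avg lin_map_compose[OF lin_map_piece lin_map_shear])

lemma lin_map_avg_Dnn:
  assumes "triangular_mesh M" and "e \<in> edges M"
  shows "lin_map (Vh M k) (polys (k - 2)) (\<lambda>v. avg M e (Dnn M e v))"
  using assms unfolding Dnn_def[abs_def]
  by (intro lin_map_avg lin_map_compose[OF lin_map_piece lin_map_dder2])

lemma polys_subset_cont_on: "polys m \<subseteq> cont_on e"
  by (auto intro: polys_continuous_on)

lemma lin_map_edge_proj: "proper_segment e \<Longrightarrow> lin_map (cont_on e) (cont_on e) (edge_proj m e)"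
  by (intro lin_mapI) (auto simp: edge_proj_continuous edge_proj_lin)

section \<open>The energy form and its control of averages\<close>

lemma bilin_on_a_form:
  assumes M: "triangular_mesh M" shows "bilin_on (Vh M k) (a_form M)"
proof -
  have "bilin_on (Vh M k) (\<lambda>w v. \<Sum>T\<in>tris M. hess_ip T (piece w T) (piece v T))"
  proof (intro bilin_on_sum bilin_on_compose[OF bilin_on_hess_ip])
    fix T assume T: "T \<in> tris M"
    show "compact T" using triangular_mesh_tris(2)[OF M T] by (rule simplex_2_plane)
    show "lin_map (Vh M k) (polys k) (\<lambda>v. piece v T)" by (rule lin_map_piece[OF M T])
    then show "lin_map (Vh M k) (polys k) (\<lambda>v. piece v T)" .
  qed
  then show ?thesis by (simp add: a_form_def[abs_def] hess_ip_def)
qed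

lemma hess_ip_le_a_form:
  assumes "triangular_mesh M" and "T \<in> tris M"
  shows "hess_ip T (piece v T) (piece v T) \<le> a_form M v v"
  unfolding a_form_def hess_ip_def[symmetric]
  using assms triangular_mesh_tris(1)[OF assms(1)] hess_ip_self_nonneg by (intro member_le_sum) auto

lemma a_form_self_nonneg: "0 \<le> a_form M v v"
  unfolding a_form_def hess_ip_def[symmetric] by (intro sum_nonneg hess_ip_self_nonneg)

text \<open>The pointwise operator bound is inserted for the one or two triangles at the edge,
  averaged by convexity of the square, and integrated over the edge.\<close>

lemma avg_ip_bound:
  assumes M: "triangular_mesh M" and e: "e \<in> edges M" and L: "lin_map (polys k) (polys m) L"
    and z: "\<And>p. p \<in> polys k \<Longrightarrow> (\<And>i j. i \<in> Basis \<Longrightarrow> j \<in> Basis \<Longrightarrow> dder i (dder j p) = (\<lambda>x. 0))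
              \<Longrightarrow> L p = (\<lambda>x. 0)"
  defines "Q \<equiv> \<lambda>v. avg M e (\<lambda>T. L (piece v T))"
  shows "\<exists>C\<ge>0. \<forall>v\<in>Vh M k. edge_ip e (Q v) (Q v) \<le> C * a_form M v v"
proof -
  have seg: "proper_segment e" using M e by (rule edge_proper_segment)
  have "\<exists>C\<ge>0. \<forall>p\<in>polys k. \<forall>x\<in>e. (L p x)\<^sup>2 \<le> C * hess_ip T p p" if "T \<in> tris M" for T
    by (rule hess_operator_bound[OF triangular_mesh_tris(2)[OF M that] L compact_proper_segment[OF seg] z])
  then obtain C where C0: "\<And>T. T \<in> tris M \<Longrightarrow> C T \<ge> 0"
    and C: "\<And>T p x. T \<in> tris M \<Longrightarrow> p \<in> polys k \<Longrightarrow> x \<in> e \<Longrightarrow> (L p x)\<^sup>2 \<le> C T * hess_ip T p p"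
    by metis
  \<comment> \<open>The sum dominates the constant of every triangle, so the triangles adjacent to
    \<open>e\<close> need only be known to belong to the mesh.\<close>
  define D where "D = (\<Sum>T\<in>tris M. C T)"
  have D0: "D \<ge> 0" unfolding D_def using C0 by (intro sum_nonneg)
  have bound: "edge_ip e (Q v) (Q v) \<le> D * edge_integral e (\<lambda>x. 1) * a_form M v v" if v: "v \<in> Vh M k" for v
  proof -
    let ?B = "D * a_form M v v"
    have L1: "(L (piece v T) x)\<^sup>2 \<le> ?B" if T: "T \<in> tris M" and x: "x \<in> e" for T x
    proof -
      have "C T \<le> D" unfolding D_def
        using T C0 triangular_mesh_tris(1)[OF M] by (intro member_le_sum) auto
      then have "C T * hess_ip T (piece v T) (piece v T) \<le> ?B"
        using D0 hess_ip_self_nonneg hess_ip_le_a_form[OF M T] by (intro mult_mono) auto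
      then show ?thesis using C[OF T Vh_piece(1)[OF M v T] x] by linarith
    qed
    have Q: "Q v x * Q v x \<le> ?B" if x: "x \<in> e" for x
    proof (cases "e \<in> boundary_edges M")
      case True
      then show ?thesis
        using L1[OF tri_plus_mem[OF M e] x] by (simp add: Q_def avg_def power2_eq_square)
    next
      case False
      define s t where "s = L (piece v (tri_plus M e)) x" and "t = L (piece v (tri_minus M e)) x"
      have "s\<^sup>2 \<le> ?B" "t\<^sup>2 \<le> ?B"
        using L1[OF tri_plus_mem[OF M e] x] L1[OF tri_minus_mem[OF M e False] x] by (simp_all add: s_def t_def)
      moreover have "(s + t) / 2 * ((s + t) / 2) \<le> (s\<^sup>2 + t\<^sup>2) / 2"
        using zero_le_power2[of "s - t"] by (simp add: power2_eq_square field_simps)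
      moreover have "(s\<^sup>2 + t\<^sup>2) / 2 \<le> ?B" using calculation by simp
      ultimately have "(s + t) / 2 * ((s + t) / 2) \<le> ?B" using order_trans by blast
      then show ?thesis using False by (simp add: Q_def avg_def s_def t_def)
    qed
    have "lin_map (Vh M k) (polys m) Q"
      unfolding Q_def by (intro lin_map_avg[OF M e] lin_map_compose[OF lin_map_piece[OF M] L])
    then have "continuous_on e (Q v)" using v by (intro polys_continuous_on) (rule lin_map_mem)
    then have "edge_ip e (Q v) (Q v) \<le> edge_integral e (\<lambda>x. ?B * 1)"
      using Q by (intro edge_integral_mono[OF seg] continuous_intros) auto
    also have "\<dots> = ?B * edge_integral e (\<lambda>x. 1)" by (intro edge_integral_scale[OF seg]) simp
    finally show ?thesis by (simp add: mult_ac)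
  qed
  have "0 \<le> D * edge_integral e (\<lambda>x. 1)"
    using D0 edge_integral_nonneg[OF seg, of "\<lambda>x. 1"] by simp
  then show ?thesis using bound by blast
qed

section \<open>Penalty and consistency terms\<close>

definition jump_ip :: "mesh \<Rightarrow> nat \<Rightarrow> plane set \<Rightarrow> (plane \<Rightarrow> real) \<Rightarrow> (plane \<Rightarrow> real) \<Rightarrow> real" where
  "jump_ip M k e w v =
     edge_ip e (edge_proj (k - 3) e (jump M e (piece w))) (edge_proj (k - 3) e (jump M e (piece v)))"

definition jump_n_ip :: "mesh \<Rightarrow> nat \<Rightarrow> plane set \<Rightarrow> (plane \<Rightarrow> real) \<Rightarrow> (plane \<Rightarrow> real) \<Rightarrow> real" where
  "jump_n_ip M k e w v =
     edge_ip e (edge_proj (k - 2) e (jump M e (Dn M e w))) (edge_proj (k - 2) e (jump M e (Dn M e v)))"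

definition penalty :: "mesh \<Rightarrow> nat \<Rightarrow> (plane \<Rightarrow> real) \<Rightarrow> (plane \<Rightarrow> real) \<Rightarrow> real" where
  "penalty M k w v = (\<Sum>e\<in>edges M. 1 / edge_length e ^ 3 * jump_ip M k e w v)"

definition penalty_n :: "mesh \<Rightarrow> nat \<Rightarrow> (plane \<Rightarrow> real) \<Rightarrow> (plane \<Rightarrow> real) \<Rightarrow> real" where
  "penalty_n M k w v = (\<Sum>e\<in>edges M. 1 / edge_length e * jump_n_ip M k e w v)"

text \<open>One half of \<open>b_form\<close> plus \<open>c_form\<close>: the higher derivatives
  fall on \<open>w\<close>, the jumps on \<open>v\<close>. The other half is obtained by exchanging
  the arguments.\<close>

definition consistency :: "mesh \<Rightarrow> (plane \<Rightarrow> real) \<Rightarrow> (plane \<Rightarrow> real) \<Rightarrow> real" where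
  "consistency M w v = (\<Sum>e\<in>edges M. edge_ip e (avg M e (Te M e w)) (jump M e (piece v))
     - edge_ip e (avg M e (Dnn M e w)) (jump M e (Dn M e v)))"

lemma lin_map_polys_cont_on: "lin_map V (polys m) X \<Longrightarrow> lin_map V (cont_on e) X"
  using lin_map_mono polys_subset_cont_on by blast

lemma bilin_on_penalties:
  assumes M: "triangular_mesh M"
  shows "bilin_on (Vh M k) (penalty M k)" and "bilin_on (Vh M k) (penalty_n M k)"
    and "bilin_on (Vh M k) (consistency M)"
proof -
  have ip: "bilin_on (Vh M k) (\<lambda>w v. edge_ip e (X w) (Y v))"
    if "e \<in> edges M" "lin_map (Vh M k) (cont_on e) X" "lin_map (Vh M k) (cont_on e) Y" for e X Y
    using that by (intro bilin_on_compose[OF bilin_on_edge_ip[OF edge_proper_segment[OF M]]])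
  have proj: "lin_map (Vh M k) (cont_on e) (\<lambda>v. edge_proj m e (X v))"
    if "e \<in> edges M" "lin_map (Vh M k) (cont_on e) X" for e m X
    using lin_map_compose[OF that(2) lin_map_edge_proj[OF edge_proper_segment[OF M that(1)]]] .
  note maps = lin_map_jump_piece[OF M, THEN lin_map_polys_cont_on]
    lin_map_jump_Dn[OF M, THEN lin_map_polys_cont_on]
    lin_map_avg_Te[OF M, THEN lin_map_polys_cont_on]
    lin_map_avg_Dnn[OF M, THEN lin_map_polys_cont_on]
  show "bilin_on (Vh M k) (penalty M k)"
    unfolding penalty_def[abs_def] jump_ip_def by (intro bilin_on_sum bilin_on_scale ip proj maps)
  show "bilin_on (Vh M k) (penalty_n M k)"
    unfolding penalty_n_def[abs_def] jump_n_ip_def by (intro bilin_on_sum bilin_on_scale ip proj maps)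
  show "bilin_on (Vh M k) (consistency M)"
    unfolding consistency_def[abs_def] by (intro bilin_on_sum bilin_on_diff ip maps)
qed

lemma A_form_eq:
  assumes M: "triangular_mesh M" and w: "w \<in> Vh M k" and v: "v \<in> Vh M k"
  shows "A_form M k \<gamma>1 \<gamma>2 w v =
    a_form M w v + consistency M w v + consistency M v w + \<gamma>1 * penalty M k w v + \<gamma>2 * penalty_n M k w v"
proof -
  have c: "continuous_on e (jump M e (piece u))" "continuous_on e (jump M e (Dn M e u))"
      "continuous_on e (avg M e (Te M e u))" "continuous_on e (avg M e (Dnn M e u))"
    if "u \<in> Vh M k" "e \<in> edges M" for u e
    using that lin_map_mem[OF lin_map_jump_piece[OF M], THEN polys_continuous_on]
      lin_map_mem[OF lin_map_jump_Dn[OF M], THEN polys_continuous_on]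
      lin_map_mem[OF lin_map_avg_Te[OF M], THEN polys_continuous_on]
      lin_map_mem[OF lin_map_avg_Dnn[OF M], THEN polys_continuous_on]
    by blast+
  have p: "continuous_on e (edge_proj m e g)" if "continuous_on e g" "e \<in> edges M" for m e g
    using that by (intro edge_proj_continuous edge_proper_segment[OF M])
  have b: "b_form M w v = (\<Sum>e\<in>edges M. edge_ip e (avg M e (Te M e w)) (jump M e (piece v))
        + edge_ip e (avg M e (Te M e v)) (jump M e (piece w)))"
    unfolding b_form_def
    by (intro sum.cong refl edge_integral_add edge_proper_segment[OF M] continuous_intros c v w)
  have c': "c_form M w v = - (\<Sum>e\<in>edges M. edge_ip e (avg M e (Dnn M e w)) (jump M e (Dn M e v))
        + edge_ip e (avg M e (Dnn M e v)) (jump M e (Dn M e w)))"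
    unfolding c_form_def
    by (intro arg_cong[where f = uminus] sum.cong refl edge_integral_add edge_proper_segment[OF M]
        continuous_intros c v w)
  have "d_form M k \<gamma>1 \<gamma>2 w v = (\<Sum>e\<in>edges M.
      \<gamma>1 / edge_length e ^ 3 * jump_ip M k e w v + \<gamma>2 / edge_length e * jump_n_ip M k e w v)"
    unfolding d_form_def
  proof (rule sum.cong[OF refl])
    fix e assume e: "e \<in> edges M"
    note seg = edge_proper_segment[OF M e]
    show "edge_integral e (\<lambda>x. \<gamma>1 / edge_length e ^ 3 *
       (edge_proj (k - 3) e (jump M e (piece w)) x * edge_proj (k - 3) e (jump M e (piece v)) x) +
       \<gamma>2 / edge_length e *
       (edge_proj (k - 2) e (jump M e (Dn M e w)) x * edge_proj (k - 2) e (jump M e (Dn M e v)) x))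
       = \<gamma>1 / edge_length e ^ 3 * jump_ip M k e w v + \<gamma>2 / edge_length e * jump_n_ip M k e w v"
      unfolding jump_ip_def jump_n_ip_def
      by (subst edge_integral_add[OF seg])
         (intro continuous_intros p c v w e
           arg_cong2[where f = "(+)"] edge_integral_scale[OF seg])+
  qed
  also have "\<dots> = \<gamma>1 * penalty M k w v + \<gamma>2 * penalty_n M k w v"
    by (simp add: penalty_def penalty_n_def sum_distrib_left sum.distrib)
  finally have d: "d_form M k \<gamma>1 \<gamma>2 w v = \<gamma>1 * penalty M k w v + \<gamma>2 * penalty_n M k w v" .
  show ?thesis
    unfolding A_form_def b c' d consistency_def by (simp add: sum.distrib sum_subtractf)
qed

lemma jump_ip_self_nonneg:
  assumes "triangular_mesh M" and "e \<in> edges M"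
  shows "0 \<le> jump_ip M k e v v" and "0 \<le> jump_n_ip M k e v v"
  using edge_ip_self_nonneg[OF edge_proper_segment[OF assms]] by (simp_all add: jump_ip_def jump_n_ip_def)

lemma penalty_self_nonneg:
  assumes "triangular_mesh M"
  shows "0 \<le> penalty M k v v" and "0 \<le> penalty_n M k v v"
  unfolding penalty_def penalty_n_def
  using jump_ip_self_nonneg[OF assms] edge_length_pos[OF edge_proper_segment[OF assms]]
  by (auto intro!: sum_nonneg mult_nonneg_nonneg simp: less_imp_le)

lemma jump_ip_le_penalty:
  assumes M: "triangular_mesh M" and e: "e \<in> edges M"
  shows "jump_ip M k e v v \<le> edge_length e ^ 3 * penalty M k v v"
    and "jump_n_ip M k e v v \<le> edge_length e * penalty_n M k v v"
proof -
  have h: "edge_length e > 0" if "e \<in> edges M" for e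
    using that by (intro edge_length_pos edge_proper_segment[OF M])
  have "1 / edge_length e ^ 3 * jump_ip M k e v v \<le> penalty M k v v"
    unfolding penalty_def using e finite_edges[OF M] jump_ip_self_nonneg[OF M] h
    by (intro member_le_sum[of e "edges M" "\<lambda>e. 1 / edge_length e ^ 3 * jump_ip M k e v v"])
       (auto simp: less_imp_le)
  then show "jump_ip M k e v v \<le> edge_length e ^ 3 * penalty M k v v"
    using h[OF e] by (simp add: field_simps)
  have "1 / edge_length e * jump_n_ip M k e v v \<le> penalty_n M k v v"
    unfolding penalty_n_def using e finite_edges[OF M] jump_ip_self_nonneg[OF M] h
    by (intro member_le_sum[of e "edges M" "\<lambda>e. 1 / edge_length e * jump_n_ip M k e v v"])
       (auto simp: less_imp_le)
  then show "jump_n_ip M k e v v \<le> edge_length e * penalty_n M k v v"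
    using h[OF e] by (simp add: field_simps)
qed

text \<open>Young's inequality is applied edge by edge. A small weight lets the averages be absorbed
  into the energy, and the price is a large factor on the projected jumps, which the penalties will
  have to exceed.\<close>

lemma consistency_bound:
  assumes M: "triangular_mesh M"
  shows "\<exists>C. \<forall>v\<in>Vh M k. 2 * \<bar>consistency M v v\<bar>
           \<le> a_form M v v / 2 + C * (penalty M k v v + penalty_n M k v v)"
proof -
  let ?E = "edges M"
  have "\<exists>C\<ge>0. \<forall>v\<in>Vh M k. edge_ip e (avg M e (Te M e v)) (avg M e (Te M e v)) \<le> C * a_form M v v"
    if "e \<in> ?E" for e
    unfolding Te_eq by (rule avg_ip_bound[OF M that lin_map_shear shear_eq_0])
  then obtain C1 where C1: "\<And>e. e \<in> ?E \<Longrightarrow> C1 e \<ge> 0" "\<And>e v. e \<in> ?E \<Longrightarrow> v \<in> Vh M k \<Longrightarrow>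
      edge_ip e (avg M e (Te M e v)) (avg M e (Te M e v)) \<le> C1 e * a_form M v v" by metis
  have "\<exists>C\<ge>0. \<forall>v\<in>Vh M k. edge_ip e (avg M e (Dnn M e v)) (avg M e (Dnn M e v)) \<le> C * a_form M v v"
    if "e \<in> ?E" for e
    unfolding Dnn_def[abs_def] by (rule avg_ip_bound[OF M that lin_map_dder2 dder_dder_eq_0])
  then obtain C2 where C2: "\<And>e. e \<in> ?E \<Longrightarrow> C2 e \<ge> 0" "\<And>e v. e \<in> ?E \<Longrightarrow> v \<in> Vh M k \<Longrightarrow>
      edge_ip e (avg M e (Dnn M e v)) (avg M e (Dnn M e v)) \<le> C2 e * a_form M v v" by metis
  \<comment> \<open>Adding 1 keeps \<open>K\<close> positive even if all constants vanish; with
    \<epsilon> = 1 / (2 K) the averages contribute at most half of the energy in total.\<close>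
  define K where "K = 1 + (\<Sum>e\<in>?E. C1 e + C2 e)"
  have K: "K \<ge> 1" using C1(1) C2(1) by (auto simp: K_def intro!: sum_nonneg)
  define \<epsilon> where "\<epsilon> = 1 / (2 * K)"
  have \<epsilon>: "\<epsilon> > 0" using K by (simp add: \<epsilon>_def)
  \<comment> \<open>The powers of the edge length undo the scaling built into the two penalty
    forms.\<close>
  define D where "D = (\<Sum>e\<in>?E. edge_length e ^ 3 + edge_length e) / \<epsilon>"
  have h: "edge_length e > 0" if "e \<in> ?E" for e
    using that by (intro edge_length_pos edge_proper_segment[OF M])
  have "2 * \<bar>consistency M v v\<bar> \<le> a_form M v v / 2 + D * (penalty M k v v + penalty_n M k v v)"
    if v: "v \<in> Vh M k" for v
  proof -
    let ?a = "a_form M v v" and ?d = "penalty M k v v + penalty_n M k v v"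
    note pn = penalty_self_nonneg[OF M, of k v]
    let ?t = "\<lambda>e. edge_ip e (avg M e (Te M e v)) (jump M e (piece v))"
    let ?n = "\<lambda>e. edge_ip e (avg M e (Dnn M e v)) (jump M e (Dn M e v))"
    have term1: "2 * \<bar>?t e\<bar> \<le> \<epsilon> * C1 e * ?a + edge_length e ^ 3 / \<epsilon> * ?d" if e: "e \<in> ?E" for e
    proof -
      note seg = edge_proper_segment[OF M e]
      let ?T = "avg M e (Te M e v)" and ?j = "jump M e (piece v)"
      have T: "?T \<in> polys (k - 3)" by (rule lin_map_mem[OF lin_map_avg_Te[OF M e] v])
      have j: "continuous_on e ?j"
        by (rule polys_continuous_on[OF lin_map_mem[OF lin_map_jump_piece[OF M e] v]])
      have "?t e = edge_ip e ?T (edge_proj (k - 3) e ?j)"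
        using edge_proj_test[OF seg j T] by (simp add: mult.commute)
      then have "2 * \<bar>?t e\<bar> \<le> \<epsilon> * edge_ip e ?T ?T + jump_ip M k e v v / \<epsilon>"
        using edge_ip_young[OF seg polys_continuous_on[OF T] edge_proj_continuous[OF seg j] \<epsilon>]
        by (simp add: jump_ip_def)
      also have "\<epsilon> * edge_ip e ?T ?T \<le> \<epsilon> * (C1 e * ?a)" using C1(2)[OF e v] \<epsilon> by simp
      also have "jump_ip M k e v v \<le> edge_length e ^ 3 * ?d"
        by (rule order_trans[OF jump_ip_le_penalty(1)[OF M e]]) (use pn h[OF e] in \<open>auto intro!: mult_left_mono\<close>)
      finally show ?thesis using \<epsilon> by (simp add: divide_right_mono mult.assoc)
    qed
    have term2: "2 * \<bar>?n e\<bar> \<le> \<epsilon> * C2 e * ?a + edge_length e / \<epsilon> * ?d" if e: "e \<in> ?E" for e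
    proof -
      note seg = edge_proper_segment[OF M e]
      let ?T = "avg M e (Dnn M e v)" and ?j = "jump M e (Dn M e v)"
      have T: "?T \<in> polys (k - 2)" by (rule lin_map_mem[OF lin_map_avg_Dnn[OF M e] v])
      have j: "continuous_on e ?j"
        by (rule polys_continuous_on[OF lin_map_mem[OF lin_map_jump_Dn[OF M e] v]])
      have "?n e = edge_ip e ?T (edge_proj (k - 2) e ?j)"
        using edge_proj_test[OF seg j T] by (simp add: mult.commute)
      then have "2 * \<bar>?n e\<bar> \<le> \<epsilon> * edge_ip e ?T ?T + jump_n_ip M k e v v / \<epsilon>"
        using edge_ip_young[OF seg polys_continuous_on[OF T] edge_proj_continuous[OF seg j] \<epsilon>]
        by (simp add: jump_n_ip_def)
      also have "\<epsilon> * edge_ip e ?T ?T \<le> \<epsilon> * (C2 e * ?a)" using C2(2)[OF e v] \<epsilon> by simp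
      also have "jump_n_ip M k e v v \<le> edge_length e * ?d"
        by (rule order_trans[OF jump_ip_le_penalty(2)[OF M e]]) (use pn h[OF e] in \<open>auto intro!: mult_left_mono\<close>)
      finally show ?thesis using \<epsilon> by (simp add: divide_right_mono mult.assoc)
    qed
    have tri: "2 * \<bar>s - t\<bar> \<le> 2 * \<bar>s\<bar> + 2 * \<bar>t\<bar>" for s t :: real
      using abs_triangle_ineq4[of s t] by (simp add: abs_if)
    have "2 * \<bar>consistency M v v\<bar> \<le> 2 * (\<Sum>e\<in>?E. \<bar>?t e - ?n e\<bar>)"
      unfolding consistency_def by (intro mult_left_mono sum_abs) auto
    also have "\<dots> = (\<Sum>e\<in>?E. 2 * \<bar>?t e - ?n e\<bar>)" by (rule sum_distrib_left)
    also have "\<dots> \<le> (\<Sum>e\<in>?E. \<epsilon> * (C1 e + C2 e) * ?a + (edge_length e ^ 3 + edge_length e) / \<epsilon> * ?d)"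
    proof (rule sum_mono)
      fix e assume e: "e \<in> ?E"
      have "2 * \<bar>?t e - ?n e\<bar> \<le> 2 * \<bar>?t e\<bar> + 2 * \<bar>?n e\<bar>"
        by (rule tri)
      also have "\<dots> \<le> (\<epsilon> * C1 e * ?a + edge_length e ^ 3 / \<epsilon> * ?d) + (\<epsilon> * C2 e * ?a + edge_length e / \<epsilon> * ?d)"
        using term1[OF e] term2[OF e] by (rule add_mono)
      also have "\<dots> = \<epsilon> * (C1 e + C2 e) * ?a + (edge_length e ^ 3 + edge_length e) / \<epsilon> * ?d"
        by (simp add: algebra_simps add_divide_distrib)
      finally show "2 * \<bar>?t e - ?n e\<bar> \<le> \<dots>" .
    qed
    also have "\<dots> = \<epsilon> * (K - 1) * ?a + D * ?d"
      unfolding K_def D_def sum.distrib[where g = "\<lambda>e. \<epsilon> * (C1 e + C2 e) * ?a"]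
      by (simp only: sum_distrib_left[symmetric] sum_distrib_right[symmetric]
          sum_divide_distrib[symmetric] add_diff_cancel_left')
    also have "\<epsilon> * (K - 1) * ?a \<le> 1 / 2 * ?a"
      using K by (intro mult_right_mono a_form_self_nonneg) (simp add: \<epsilon>_def field_simps)
    finally show ?thesis by simp
  qed
  then show ?thesis by blast
qed

lemma Vh_inf_orthogonal:
  assumes "v \<in> Vh_inf M k" and "e \<in> edges M"
  shows "p \<in> polys (k - 3) \<Longrightarrow> edge_ip e (jump M e (piece v)) p = 0"
    and "q \<in> polys (k - 2) \<Longrightarrow> edge_ip e (jump M e (Dn M e v)) q = 0"
  using assms by (auto simp: Vh_inf_def)

lemma Vh_inf_subset: "Vh_inf M k \<subseteq> Vh M k"
  by (auto simp: Vh_inf_def)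

lemma Vh_inf_annihilates:
  assumes M: "triangular_mesh M" and v: "v \<in> Vh M k" and w: "w \<in> Vh_inf M k"
  shows "consistency M v w = 0" and "penalty M k w v = 0" and "penalty_n M k w v = 0"
proof -
  have wV: "w \<in> Vh M k" using w Vh_inf_subset by blast
  have "edge_ip e (avg M e (Te M e v)) (jump M e (piece w)) = 0"
      "edge_ip e (avg M e (Dnn M e v)) (jump M e (Dn M e w)) = 0" if e: "e \<in> edges M" for e
    using Vh_inf_orthogonal(1)[OF w e lin_map_mem[OF lin_map_avg_Te[OF M e] v]]
      Vh_inf_orthogonal(2)[OF w e lin_map_mem[OF lin_map_avg_Dnn[OF M e] v]]
    by (simp_all add: mult.commute)
  then show "consistency M v w = 0" by (simp add: consistency_def)
  have "edge_proj (k - 3) e (jump M e (piece w)) = (\<lambda>x. 0)"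
      "edge_proj (k - 2) e (jump M e (Dn M e w)) = (\<lambda>x. 0)" if e: "e \<in> edges M" for e
    using Vh_inf_orthogonal[OF w e] lin_map_mem[OF lin_map_jump_piece[OF M e] wV]
      lin_map_mem[OF lin_map_jump_Dn[OF M e] wV]
    by (auto simp: edge_proj_eq_0_iff edge_proper_segment[OF M e] polys_continuous_on)
  then show "penalty M k w v = 0" "penalty_n M k w v = 0"
    by (simp_all add: penalty_def penalty_n_def jump_ip_def jump_n_ip_def)
qed

text \<open>Inside \<open>Vh\<close> the constrained subspace is the common kernel of finitely many
  functionals, the moments of the jumps against monomials. Hence \<open>G\<close> is a linear
  combination of these moments, and the penalty forms bound the square of each of them.\<close>

lemma functional_penalty_bound:
  assumes M: "triangular_mesh M" and G: "lin_on (Vh M k) G" and 0: "\<And>v. v \<in> Vh_inf M k \<Longrightarrow> G v = 0"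
  shows "\<exists>c. \<forall>v\<in>Vh M k. (G v)\<^sup>2 \<le> c * (penalty M k v v + penalty_n M k v v)"
proof -
  let ?V = "Vh M k"
  \<comment> \<open>A disjoint sum, because jumps and normal-derivative jumps are tested with
    monomials of different degrees and the index sets would otherwise overlap.\<close>
  let ?I = "(edges M \<times> monomials (k - 3)) <+> (edges M \<times> monomials (k - 2))"
  define J where "J = case_sum (\<lambda>(e, ij) v. edge_ip e (jump M e (piece v)) (mon ij))
      (\<lambda>(e, ij) v. edge_ip e (jump M e (Dn M e v)) (mon ij))"
  have Jl: "J (Inl (e, ij)) v = edge_ip e (jump M e (piece v)) (mon ij)"
    and Jr: "J (Inr (e, ij)) v = edge_ip e (jump M e (Dn M e v)) (mon ij)" for e ij v
    by (simp_all add: J_def)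
  have fin: "finite ?I" using finite_edges[OF M] by simp
  note jp = lin_map_jump_piece[OF M, of _ k] and jn = lin_map_jump_Dn[OF M, of _ k]
  have mom: "lin_on ?V (\<lambda>v. edge_ip e (X v) (mon ij))"
    if "e \<in> edges M" "lin_map ?V (polys m) X" "ij \<in> monomials n" for e X m n ij
    by (rule lin_on_compose[OF bilin_on_left[OF bilin_on_edge_ip[OF edge_proper_segment[OF M that(1)]]]
          lin_map_polys_cont_on[OF that(2)]])
       (use mon_mem_polys[OF that(3)] polys_subset_cont_on in blast)
  \<comment> \<open>The family \<open>J\<close> contains only monomial moments, while the
    constraints quantify over all polynomials of the given degree.\<close>
  have extend: "edge_ip e g p = 0"
    if "e \<in> edges M" "g \<in> polys m" "p \<in> polys n" "\<And>ij. ij \<in> monomials n \<Longrightarrow> edge_ip e g (mon ij) = 0"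
    for e g m p n
  proof -
    have "lin_on (polys n) (edge_ip e g)"
      using bilin_on_right[OF bilin_on_edge_ip[OF edge_proper_segment[OF M that(1)]], of g]
        polys_continuous_on[OF that(2)] lin_on_subset[OF _ polys_subset_cont_on] by blast
    from polys_functional_lincomb[OF this that(3)] show ?thesis using that(4) by simp
  qed
  have "\<exists>c. \<forall>v\<in>?V. G v = (\<Sum>i\<in>?I. c i * J i v)"
  proof (rule functional_in_span[OF fin lin_closed_Vh[OF M] _ G])
    show "lin_on ?V (J i)" if i: "i \<in> ?I" for i
    proof -
      consider e ij where "i = Inl (e, ij)" "e \<in> edges M" "ij \<in> monomials (k - 3)"
        | e ij where "i = Inr (e, ij)" "e \<in> edges M" "ij \<in> monomials (k - 2)" using i by auto
      then show ?thesis
      proof cases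
        case 1
        then show ?thesis unfolding 1(1) J_def sum.case split by (intro mom[OF _ jp])
      next
        case 2
        then show ?thesis unfolding 2(1) J_def sum.case split by (intro mom[OF _ jn])
      qed
    qed
    fix v assume v: "v \<in> ?V" and Jv: "\<And>i. i \<in> ?I \<Longrightarrow> J i v = 0"
    have "edge_ip e (jump M e (piece v)) p = 0" if e: "e \<in> edges M" and p: "p \<in> polys (k - 3)" for e p
    proof (rule extend[OF e lin_map_mem[OF jp[OF e] v] p])
      show "edge_ip e (jump M e (piece v)) (mon ij) = 0" if "ij \<in> monomials (k - 3)" for ij
        unfolding Jl[symmetric] by (rule Jv) (use e that in blast)
    qed
    moreover have "edge_ip e (jump M e (Dn M e v)) p = 0" if e: "e \<in> edges M" and p: "p \<in> polys (k - 2)" for e p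
    proof (rule extend[OF e lin_map_mem[OF jn[OF e] v] p])
      show "edge_ip e (jump M e (Dn M e v)) (mon ij) = 0" if "ij \<in> monomials (k - 2)" for ij
        unfolding Jr[symmetric] by (rule Jv) (use e that in blast)
    qed
    ultimately have "v \<in> Vh_inf M k" using v by (simp add: Vh_inf_def)
    then show "G v = 0" by (rule 0)
  qed
  then obtain c where c: "\<And>v. v \<in> ?V \<Longrightarrow> G v = (\<Sum>i\<in>?I. c i * J i v)" by blast
  let ?d = "\<lambda>v. penalty M k v v + penalty_n M k v v"
  have "\<exists>b. \<forall>v\<in>?V. (J i v)\<^sup>2 \<le> b * ?d v" if i: "i \<in> ?I" for i
  proof -
    consider e ij where "i = Inl (e, ij)" "e \<in> edges M" "ij \<in> monomials (k - 3)"
      | e ij where "i = Inr (e, ij)" "e \<in> edges M" "ij \<in> monomials (k - 2)" using i by auto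
    then show ?thesis
    proof cases
      case 1
      note seg = edge_proper_segment[OF M 1(2)]
      let ?m = "edge_ip e (mon ij) (mon ij)"
      have "(J i v)\<^sup>2 \<le> ?m * edge_length e ^ 3 * ?d v" if v: "v \<in> ?V" for v
      proof -
        have "(J i v)\<^sup>2 \<le> ?m * jump_ip M k e v v"
          unfolding 1(1) Jl jump_ip_def using lin_map_mem[OF jp[OF 1(2)] v]
          by (intro edge_ip_test_bound[OF seg] mon_mem_polys[OF 1(3)] polys_continuous_on)
        also have "\<dots> \<le> ?m * (edge_length e ^ 3 * penalty M k v v)"
          using edge_ip_self_nonneg[OF seg] by (intro mult_left_mono jump_ip_le_penalty[OF M 1(2)])
        also have "\<dots> \<le> ?m * (edge_length e ^ 3 * ?d v)"
          using edge_ip_self_nonneg[OF seg] edge_length_pos[OF seg] penalty_self_nonneg[OF M, of k v]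
          by (intro mult_left_mono) auto
        finally show ?thesis by (simp add: mult.assoc)
      qed
      then show ?thesis by blast
    next
      case 2
      note seg = edge_proper_segment[OF M 2(2)]
      let ?m = "edge_ip e (mon ij) (mon ij)"
      have "(J i v)\<^sup>2 \<le> ?m * edge_length e * ?d v" if v: "v \<in> ?V" for v
      proof -
        have "(J i v)\<^sup>2 \<le> ?m * jump_n_ip M k e v v"
          unfolding 2(1) Jr jump_n_ip_def using lin_map_mem[OF jn[OF 2(2)] v]
          by (intro edge_ip_test_bound[OF seg] mon_mem_polys[OF 2(3)] polys_continuous_on)
        also have "\<dots> \<le> ?m * (edge_length e * penalty_n M k v v)"
          using edge_ip_self_nonneg[OF seg] by (intro mult_left_mono jump_ip_le_penalty[OF M 2(2)])
        also have "\<dots> \<le> ?m * (edge_length e * ?d v)"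
          using edge_ip_self_nonneg[OF seg] edge_length_pos[OF seg] penalty_self_nonneg[OF M, of k v]
          by (intro mult_left_mono) auto
        finally show ?thesis by (simp add: mult.assoc)
      qed
      then show ?thesis by blast
    qed
  qed
  then obtain b where b: "\<And>i v. i \<in> ?I \<Longrightarrow> v \<in> ?V \<Longrightarrow> (J i v)\<^sup>2 \<le> b i * ?d v" by metis
  have "(G v)\<^sup>2 \<le> (\<Sum>i\<in>?I. (c i)\<^sup>2) * (\<Sum>i\<in>?I. b i) * ?d v" if v: "v \<in> ?V" for v
  proof -
    have "(G v)\<^sup>2 \<le> (\<Sum>i\<in>?I. (c i)\<^sup>2) * (\<Sum>i\<in>?I. (J i v)\<^sup>2)"
      unfolding c[OF v] by (rule Cauchy_Schwarz_ineq_sum)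
    also have "\<dots> \<le> (\<Sum>i\<in>?I. (c i)\<^sup>2) * (\<Sum>i\<in>?I. b i * ?d v)"
      using b v by (intro mult_left_mono sum_mono sum_nonneg) auto
    also have "\<dots> = (\<Sum>i\<in>?I. (c i)\<^sup>2) * (\<Sum>i\<in>?I. b i) * ?d v"
      by (simp only: sum_distrib_right mult.assoc)
    finally show ?thesis .
  qed
  then show ?thesis by blast
qed

lemma norm_h_eq: "norm_h M k v = sqrt (a_form M v v + penalty M k v v + penalty_n M k v v)"
  unfolding norm_h_def a_form_def penalty_def penalty_n_def jump_ip_def jump_n_ip_def power2_eq_square
  by (simp add: add_ac)

theorem proposition3p4:
  fixes M :: mesh and \<kappa> :: real and k :: nat and f :: "real ^ 2 \<Rightarrow> real"
    and u :: "real \<Rightarrow> real \<Rightarrow> real ^ 2 \<Rightarrow> real" and u_inf :: "real ^ 2 \<Rightarrow> real"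
  assumes "triangular_mesh M" and "shape_regular \<kappa> (tris M)"
    and "k \<in> {3, 4}"
    and "square_integrable_on f (dom_of M)"
    and "\<And>\<gamma>1 \<gamma>2. \<gamma>1 > 0 \<Longrightarrow> \<gamma>2 > 0 \<Longrightarrow> coercive M k \<gamma>1 \<gamma>2 \<Longrightarrow>
           discrete_solution M k f \<gamma>1 \<gamma>2 (u \<gamma>1 \<gamma>2)"
    and "limit_solution M k f u_inf"
  shows "((\<lambda>(\<gamma>1, \<gamma>2). norm_h M k (\<lambda>x. u \<gamma>1 \<gamma>2 x - u_inf x)) \<longlongrightarrow> 0) (at_top \<times>\<^sub>F at_top)"
proof -
  note M = assms(1)
  let ?E = "\<lambda>v. a_form M v v + penalty M k v v + penalty_n M k v v"
  obtain C where C: "\<And>v. v \<in> Vh M k \<Longrightarrow>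
      2 * \<bar>consistency M v v\<bar> \<le> a_form M v v / 2 + C * (penalty M k v v + penalty_n M k v v)"
    using consistency_bound[OF M] by blast
  have u: "u \<gamma>1 \<gamma>2 \<in> Vh M k \<and> (\<forall>v\<in>Vh M k. A_form M k \<gamma>1 \<gamma>2 (u \<gamma>1 \<gamma>2) v = load M f v)"
    if "\<gamma>1 > 0" "\<gamma>2 > 0" and co: "\<exists>\<alpha>>0. \<forall>v\<in>Vh M k. \<alpha> * ?E v \<le> A_form M k \<gamma>1 \<gamma>2 v v" for \<gamma>1 \<gamma>2
  proof -
    \<comment> \<open>The radicand is nonnegative, so coercivity in terms of \<open>?E\<close> is
      the predicate \<open>coercive\<close>, under which the discrete equation is available.\<close>
    have "(norm_h M k v)\<^sup>2 = ?E v" for v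
      unfolding norm_h_eq using a_form_self_nonneg penalty_self_nonneg[OF M]
      by (intro real_sqrt_pow2 add_nonneg_nonneg)
    then have "coercive M k \<gamma>1 \<gamma>2" using co by (simp add: coercive_def)
    then show ?thesis using assms(5) that by (simp add: discrete_solution_def)
  qed
  have "((\<lambda>(\<gamma>1, \<gamma>2). ?E (\<lambda>x. u \<gamma>1 \<gamma>2 x - u_inf x)) \<longlongrightarrow> 0) (at_top \<times>\<^sub>F at_top)"
  proof (rule penalty_convergence[where V = "Vh M k" and a = "a_form M" and ?d1.0 = "penalty M k" and ?d2.0 = "penalty_n M k" and R = "consistency M" and A = "A_form M k"
        and Vinf = "Vh_inf M k" and F = "load M f" and C = C and u = u])
    show "a_form M u_inf v = load M f v" if "v \<in> Vh_inf M k" for v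
      using assms(6) that by (simp add: limit_solution_def)
    show "u_inf \<in> Vh_inf M k" using assms(6) by (simp add: limit_solution_def)
    show "\<exists>c. \<forall>v\<in>Vh M k. (G v)\<^sup>2 \<le> c * (penalty M k v v + penalty_n M k v v)"
      if "lin_on (Vh M k) G" "\<And>v. v \<in> Vh_inf M k \<Longrightarrow> G v = 0" for G
      using functional_penalty_bound[OF M that] .
  qed (rule lin_closed_Vh[OF M] Vh_inf_subset bilin_on_a_form[OF M] bilin_on_penalties[OF M]
      a_form_self_nonneg penalty_self_nonneg[OF M] Vh_inf_annihilates[OF M] C
      A_form_eq[OF M] lin_on_load[OF assms(4)] u | assumption)+
  \<comment> \<open>The abstract result concerns the squared norm; continuity of the square root at
    0 transfers the limit to the norm.\<close>
  then have "((\<lambda>p. sqrt (case p of (\<gamma>1, \<gamma>2) \<Rightarrow> ?E (\<lambda>x. u \<gamma>1 \<gamma>2 x - u_inf x))) \<longlongrightarrow> sqrt 0) (at_top \<times>\<^sub>F at_top)"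
    by (rule tendsto_real_sqrt)
  then show ?thesis by (simp add: norm_h_eq split_def)
qed

end
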